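(* The Clifford isoparametric family with multiplicities $(9,6)$ (arising from a Clifford system $(P_0,\dots,P_9)$ on $\mathbb{R}^{32}$) is homogeneous. Thus, in particular, it is not congruent to the Clifford family with multiplicities $(6,9)$ (arising from a Clifford system $(P_0,\dots,P_6)$ on $\mathbb{R}^{32}$).
   Context: A (symmetric) Clifford system on $\mathbb{R}^{2l}$ is an $(m+1)$-tuple $(P_0,\dots,P_m)$ of symmetric endomorphisms of $\mathbb{R}^{2l}$ with $P_iP_j+P_jP_i=2\delta_{ij}\,\mathrm{Id}$ for all $i,j$. Put $m_1=m$, $m_2=l-m-1$. If $m_2>0$, the associated Clifford isoparametric family of multiplicities $(m_1,m_2)$ consists of the level sets $f^{-1}(c)$, $-1<c<1$, of $f(x)=1-2\sum_{i=0}^m\langle P_ix,x\rangle^2$ on $S^{2l-1}$ (a parallel family of hypersurfaces with four distinct constant principal curvatures of multiplicities $m_1,m_2,m_1,m_2$). For multiplicities $(9,6)$ and for $(6,9)$ such a family is unique up to congruence. The family is homogeneous if each of its hypersurfaces $M$ is homogeneously embedded, i.e. the group $\{A\in O(2l)\mid A(M)=M\}$ acts transitively on $M$. Two families in $S^{2l-1}$ are congruent if an orthogonal transformation of $\mathbb{R}^{2l}$ carries the hypersurfaces of one onto those of the other. *)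

theory Defs
  imports "HOL-Analysis.Analysis"
begin

text \<open>
  A Clifford system \<open>(P\<^sub>0, \<dots>, P\<^sub>m)\<close> is given by a sequence \<open>P\<close> of which only the
  members with index at most \<open>m\<close> matter.
\<close>

definition symmetric_endomorphism :: "('a::euclidean_space \<Rightarrow> 'a) \<Rightarrow> bool" where
  "symmetric_endomorphism T \<longleftrightarrow> linear T \<and> (\<forall>x y. T x \<bullet> y = x \<bullet> T y)"

definition clifford_system :: "nat \<Rightarrow> (nat \<Rightarrow> 'a::euclidean_space \<Rightarrow> 'a) \<Rightarrow> bool" where
  "clifford_system m P \<longleftrightarrow>
     (\<forall>i\<le>m. symmetric_endomorphism (P i)) \<and>
     (\<forall>i\<le>m. \<forall>j\<le>m. \<forall>x. P i (P j x) + P j (P i x) = (if i = j then 2 else 0) *\<^sub>R x)"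

definition clifford_function :: "nat \<Rightarrow> (nat \<Rightarrow> 'a::euclidean_space \<Rightarrow> 'a) \<Rightarrow> 'a \<Rightarrow> real" where
  "clifford_function m P x = 1 - 2 * (\<Sum>i=0..m. (P i x \<bullet> x)\<^sup>2)"

definition clifford_hypersurface ::
    "nat \<Rightarrow> (nat \<Rightarrow> 'a::euclidean_space \<Rightarrow> 'a) \<Rightarrow> real \<Rightarrow> 'a set" where
  "clifford_hypersurface m P c = {x \<in> sphere 0 1. clifford_function m P x = c}"

text \<open>
  A family of hypersurfaces is the set of its members, so it carries no preferred
  parametrization or normal direction. The condition on the dimension says that the ambient
  space has dimension \<open>2 l\<close> with \<open>m\<^sub>2 = l - m\<^sub>1 - 1\<close>.
\<close>

definition clifford_isoparametric_family ::
    "nat \<Rightarrow> nat \<Rightarrow> 'a::euclidean_space set set \<Rightarrow> bool" where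
  "clifford_isoparametric_family m1 m2 F \<longleftrightarrow>
     m2 > 0 \<and> DIM('a) = 2 * (m1 + m2 + 1) \<and>
     (\<exists>P. clifford_system m1 P \<and> F = clifford_hypersurface m1 P ` {-1<..<1})"

definition orthogonal_stabilizer :: "'a::euclidean_space set \<Rightarrow> ('a \<Rightarrow> 'a) set" where
  "orthogonal_stabilizer M = {A. orthogonal_transformation A \<and> A ` M = M}"

definition homogeneously_embedded :: "'a::euclidean_space set \<Rightarrow> bool" where
  "homogeneously_embedded M \<longleftrightarrow> (\<forall>x\<in>M. \<forall>y\<in>M. \<exists>A\<in>orthogonal_stabilizer M. A x = y)"

definition homogeneous_family :: "'a::euclidean_space set set \<Rightarrow> bool" where
  "homogeneous_family F \<longleftrightarrow> (\<forall>M\<in>F. homogeneously_embedded M)"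

definition congruent_families ::
    "'a::euclidean_space set set \<Rightarrow> 'a set set \<Rightarrow> bool" where
  "congruent_families F G \<longleftrightarrow> (\<exists>A. orthogonal_transformation A \<and> (\<lambda>M. A ` M) ` F = G)"

end

theory Submission
  imports Defs
begin

text \<open>
  The unit vectors of \<open>span (P\<^sub>0, \<dots>, P\<^sub>9)\<close> act by isometries preserving \<open>q x = \<Sum>i. \<langle>P\<^sub>i x, x\<rangle>\<^sup>2\<close>,
  and the group they generate, \<open>Pin(10)\<close>, is already transitive on each level set. One of them
  turns the vector \<open>\<langle>P\<^sub>i x, x\<rangle>\<^sub>i\<close> into the direction of \<open>P\<^sub>0\<close>. Products of two then move the
  \<open>P\<^sub>0\<close>-positive part of \<open>x\<close> first into a half-spin representation of \<open>Spin(8)\<close> and there to a given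
  ray, because the Clifford products of a vector of one half-spin representation fill the
  other one. The \<open>P\<^sub>0\<close>-negative part then lies, up to \<open>P\<^sub>9\<close>, in the complement of that ray in the same
  half-spin representation, and products of four move it to a given ray.

  A congruence with a family of multiplicities \<open>(6,9)\<close>, given by \<open>Q\<^sub>0, \<dots>, Q\<^sub>6\<close>, carries focal points
  to focal points. If a point with \<open>q = 1\<close> went to a point with \<open>q = 1\<close>, a 25-dimensional cone
  tangent space would lie in one of dimension at most 23. Otherwise all forms \<open>\<langle>Q\<^sub>j x, x\<rangle>\<close> vanish
  on the eigenspaces of all \<open>P\<^sub>i\<close>, so the \<open>Q\<^sub>j\<close> anticommute with the \<open>P\<^sub>i\<close>; the skew map \<open>Q\<^sub>0 Q\<^sub>1\<close> then
  commutes with all \<open>P\<^sub>i\<close>, which the transitivity of the stabilizer of a half-spinor rules out.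
\<close>

text \<open>\<open>S\<close> exchanges the two eigenspaces of \<open>T\<close> injectively, so their
  dimensions agree; they span \<open>V\<close> because \<open>x\<close> is half the sum of
  \<open>x + T x\<close> and \<open>x - T x\<close>.\<close>

lemma dim_eigenspace_involution:
  fixes T S :: "'a::euclidean_space \<Rightarrow> 'a"
  assumes V: "subspace V" and T: "linear T" "\<And>x. x \<in> V \<Longrightarrow> T x \<in> V" "\<And>x. x \<in> V \<Longrightarrow> T (T x) = x"
    and S: "linear S" "\<And>x. x \<in> V \<Longrightarrow> S x \<in> V" "inj_on S V" "\<And>x. x \<in> V \<Longrightarrow> S (T x) = - T (S x)"
    and e: "e = 1 \<or> e = -1"
  shows "2 * dim {x \<in> V. T x = e *\<^sub>R x} = dim V"
proof -
  interpret T: linear T by fact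
  interpret S: linear S by fact
  define E where "E = (\<lambda>e. {x \<in> V. T x = e *\<^sub>R x})"
  have sub: "subspace (E e)" for e
    using V unfolding E_def subspace_def by (auto simp: T.add T.scale T.zero algebra_simps)
  have le: "dim (E e) \<le> dim (E (- e))" for e
  proof -
    have "dim (S ` E e) = dim (E e)"
      using S(1) by (rule dim_image_eq) (use sub S(3) in \<open>auto simp: E_def span_eq_iff[THEN iffD2] intro: inj_on_subset\<close>)
    moreover have "S ` E e \<subseteq> E (- e)"
      using S T by (auto simp: E_def) (metis S.scale add.inverse_inverse)
    ultimately show ?thesis by (metis dim_subset)
  qed
  have "V \<subseteq> {x + y |x y. x \<in> E 1 \<and> y \<in> E (-1)}"
  proof
    fix x assume x: "x \<in> V"
    have "x = (1/2) *\<^sub>R (x + T x) + (1/2) *\<^sub>R (x - T x)" by (simp add: algebra_simps flip: scaleR_add_left)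
    moreover have "(1/2) *\<^sub>R (x + T x) \<in> E 1" "(1/2) *\<^sub>R (x - T x) \<in> E (-1)"
      using x V T by (auto simp: E_def subspace_def subspace_diff T.scale T.add T.diff algebra_simps)
    ultimately show "x \<in> {x + y |x y. x \<in> E 1 \<and> y \<in> E (-1)}" by blast
  qed
  moreover have "{x + y |x y. x \<in> E 1 \<and> y \<in> E (-1)} \<subseteq> V"
    using V by (auto simp: E_def subspace_add)
  ultimately have "V = {x + y |x y. x \<in> E 1 \<and> y \<in> E (-1)}" by blast
  moreover have "E 1 \<inter> E (-1) = {0}"
  proof -
    have "x = 0" if "x = - x" for x :: 'a using that by (metis eq_neg_iff_add_eq_0 scaleR_2 scaleR_eq_0_iff zero_neq_numeral)
    with V show ?thesis by (auto simp: E_def subspace_0 T.zero)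
  qed
  ultimately have "dim V = dim (E 1) + dim (E (-1))"
    using dim_sums_Int[OF sub sub, of 1 "-1"] by simp
  moreover have "dim (E 1) = dim (E (-1))" using le[of 1] le[of "-1"] by simp
  ultimately have "2 * dim (E e) = dim V" using e by auto
  thus ?thesis by (simp add: E_def)
qed

section \<open>Clifford systems\<close>

locale clifford =
  fixes m :: nat and P :: "nat \<Rightarrow> 'a::euclidean_space \<Rightarrow> 'a"
  assumes clifford: "clifford_system m P"
begin

lemma linear_P: "i \<le> m \<Longrightarrow> linear (P i)"
  and sym: "i \<le> m \<Longrightarrow> P i x \<bullet> y = x \<bullet> P i y"
  using clifford by (auto simp: clifford_system_def symmetric_endomorphism_def)

lemma P_P: "i \<le> m \<Longrightarrow> P i (P i x) = x"
proof -
  assume "i \<le> m"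
  hence "P i (P i x) + P i (P i x) = 2 *\<^sub>R x" using clifford by (auto simp: clifford_system_def)
  hence "2 *\<^sub>R P i (P i x) = 2 *\<^sub>R x" by (simp add: scaleR_2)
  thus ?thesis by simp
qed

lemma anti: "i \<le> m \<Longrightarrow> j \<le> m \<Longrightarrow> i \<noteq> j \<Longrightarrow> P j (P i x) = - P i (P j x)"
  using clifford by (auto simp: clifford_system_def eq_neg_iff_add_eq_0)

lemma P_simps:
  assumes "i \<le> m"
  shows "P i (x + y) = P i x + P i y" "P i (x - y) = P i x - P i y" "P i (- x) = - P i x"
    "P i (c *\<^sub>R x) = c *\<^sub>R P i x" "P i 0 = 0"
  using linear_P[OF assms] by (auto simp: linear_add linear_diff linear_neg linear_scale linear_0)

lemma inner_P_P: "i \<le> m \<Longrightarrow> P i x \<bullet> P i y = x \<bullet> y"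
  by (simp add: sym P_P)

lemma norm_P: "i \<le> m \<Longrightarrow> norm (P i x) = norm x"
  by (simp add: norm_eq_sqrt_inner inner_P_P)

lemma inner_P_anti: "i \<le> m \<Longrightarrow> j \<le> m \<Longrightarrow> i \<noteq> j \<Longrightarrow> P i x \<bullet> P j x = 0"
proof -
  assume a: "i \<le> m" "j \<le> m" "i \<noteq> j"
  have "P i x \<bullet> P j x = x \<bullet> P i (P j x)" using a by (simp add: sym)
  also have "\<dots> = - (x \<bullet> P j (P i x))" using a by (subst anti) auto
  also have "\<dots> = - (P j x \<bullet> P i x)" using a by (simp add: sym)
  finally show ?thesis by (simp add: inner_commute)
qed

section \<open>Linear combinations of the members of a system\<close>

definition sp :: "nat set \<Rightarrow> ('a \<Rightarrow> 'a) set" where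
  "sp I = {T. \<exists>a. T = (\<lambda>x. \<Sum>i\<in>I. a i *\<^sub>R P i x)}"

lemma sp_I: "(\<lambda>x. \<Sum>i\<in>I. a i *\<^sub>R P i x) \<in> sp I"
  unfolding sp_def by (rule CollectI, rule exI[of _ a], rule refl)

lemma sp_E:
  assumes "T \<in> sp I"
  obtains a where "T = (\<lambda>x. \<Sum>i\<in>I. a i *\<^sub>R P i x)"
  using assms unfolding sp_def by (elim CollectE exE) (rule that)

lemma linear_sp:
  assumes "T \<in> sp I" "I \<subseteq> {..m}"
  shows "linear T"
proof -
  obtain a where T: "T = (\<lambda>x. \<Sum>i\<in>I. a i *\<^sub>R P i x)" using assms by (auto simp: sp_def)
  show ?thesis unfolding T
    by (intro linear_compose_sum ballI linear_compose_scale_right linear_P) (use assms in auto)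
qed

lemma sp_simps:
  assumes "T \<in> sp I" "I \<subseteq> {..m}"
  shows "T (x + y) = T x + T y" "T (x - y) = T x - T y" "T (- x) = - T x"
    "T (c *\<^sub>R x) = c *\<^sub>R T x" "T 0 = 0"
  using linear_sp[OF assms] by (auto simp: linear_add linear_diff linear_neg linear_scale linear_0)

lemma sym_sp:
  assumes "T \<in> sp I" "I \<subseteq> {..m}"
  shows "T x \<bullet> y = x \<bullet> T y"
proof -
  obtain a where T: "T = (\<lambda>x. \<Sum>i\<in>I. a i *\<^sub>R P i x)" using assms by (auto simp: sp_def)
  show ?thesis unfolding T inner_sum_left inner_sum_right
    by (intro sum.cong refl) (use assms sym in auto)
qed

text \<open>The \<open>P i x\<close> are pairwise orthogonal of length \<open>norm x\<close>. Hence
  \<open>norm (T p) = 1\<close> for one unit vector \<open>p\<close> says that \<open>T\<close> has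
  a unit coefficient vector, whichever \<open>p\<close> is used; later lemmas express unit elements
  in this way.\<close>

lemma inner_sp_sp:
  assumes "I \<subseteq> {..m}"
  shows "(\<Sum>i\<in>I. a i *\<^sub>R P i x) \<bullet> (\<Sum>i\<in>I. b i *\<^sub>R P i x) = (\<Sum>i\<in>I. a i * b i) * (x \<bullet> x)"
proof -
  have fin: "finite I" using assms finite_subset by blast
  have "(\<Sum>i\<in>I. a i *\<^sub>R P i x) \<bullet> (\<Sum>i\<in>I. b i *\<^sub>R P i x)
      = (\<Sum>i\<in>I. \<Sum>j\<in>I. a i * b j * (P i x \<bullet> P j x))"
    unfolding inner_sum_left by (intro sum.cong refl) (simp add: inner_sum_right sum_distrib_left ac_simps)
  also have "\<dots> = (\<Sum>i\<in>I. \<Sum>j\<in>I. if i = j then a i * b i * (x \<bullet> x) else 0)"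
    using assms by (intro sum.cong refl) (auto simp: inner_P_anti inner_P_P subset_iff)
  also have "\<dots> = (\<Sum>i\<in>I. a i * b i) * (x \<bullet> x)" using fin by (simp add: sum_distrib_right)
  finally show ?thesis .
qed

lemma sp_mono: "I \<subseteq> J \<Longrightarrow> finite J \<Longrightarrow> sp I \<subseteq> sp J"
proof
  fix T assume a: "I \<subseteq> J" "finite J" "T \<in> sp I"
  then obtain a where "T = (\<lambda>x. \<Sum>i\<in>I. a i *\<^sub>R P i x)" by (auto simp: sp_def)
  moreover have "(\<Sum>i\<in>I. a i *\<^sub>R P i x) = (\<Sum>i\<in>J. (if i \<in> I then a i else 0) *\<^sub>R P i x)" for x
    using a by (intro sum.mono_neutral_cong_left) auto
  ultimately show "T \<in> sp J" unfolding sp_def by (intro CollectI exI[of _ "\<lambda>i. if i \<in> I then a i else 0"]) auto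
qed

lemma P_in_sp: "i \<in> I \<Longrightarrow> finite I \<Longrightarrow> P i \<in> sp I"
  unfolding sp_def
  by (intro CollectI exI[of _ "\<lambda>j. if j = i then 1 else 0"]) (auto simp: if_distrib[of "\<lambda>a. a *\<^sub>R _"] sum.delta cong: if_cong)

lemma sp_add: "S \<in> sp I \<Longrightarrow> T \<in> sp I \<Longrightarrow> (\<lambda>x. S x + T x) \<in> sp I"
proof -
  assume "S \<in> sp I" "T \<in> sp I"
  then obtain a b where "S = (\<lambda>x. \<Sum>i\<in>I. a i *\<^sub>R P i x)" "T = (\<lambda>x. \<Sum>i\<in>I. b i *\<^sub>R P i x)" by (auto simp: sp_def)
  thus ?thesis unfolding sp_def
    by (intro CollectI exI[of _ "\<lambda>i. a i + b i"]) (auto simp: sum.distrib algebra_simps)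
qed

lemma sp_scale: "S \<in> sp I \<Longrightarrow> (\<lambda>x. c *\<^sub>R S x) \<in> sp I"
proof -
  assume "S \<in> sp I"
  then obtain a where "S = (\<lambda>x. \<Sum>i\<in>I. a i *\<^sub>R P i x)" by (auto simp: sp_def)
  thus ?thesis unfolding sp_def
    by (intro CollectI exI[of _ "\<lambda>i. c * a i"]) (auto simp: scaleR_right.sum)
qed

text \<open>Evaluation at a nonzero vector loses no dimension. Both the transitivity on half-spinors
  and the comparison of tangent spaces rest on this count.\<close>

lemma sp_image:
  assumes I: "I \<subseteq> {..m}" and x: "x \<noteq> 0"
  shows "subspace {T x |T. T \<in> sp I}" "dim {T x |T. T \<in> sp I} = card I"
    "{T x |T. T \<in> sp I} = span ((\<lambda>i. P i x) ` I)"
proof -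
  have fin: "finite I" using I finite_subset by blast
  let ?N = "{T x |T. T \<in> sp I}" and ?B = "(\<lambda>i. P i x) ` I"
  show sub: "subspace ?N"
  proof (rule subspaceI)
    show "0 \<in> ?N" using sp_I[of "\<lambda>i. 0" I] by (auto intro!: exI[of _ "\<lambda>x. 0"])
    show "y + z \<in> ?N" if "y \<in> ?N" "z \<in> ?N" for y z using that sp_add by fastforce
    show "c *\<^sub>R y \<in> ?N" if "y \<in> ?N" for c y using that sp_scale by fastforce
  qed
  have ip: "P i x \<bullet> P j x = (if i = j then x \<bullet> x else 0)" if "i \<in> I" "j \<in> I" for i j
    using that I by (auto simp: inner_P_P inner_P_anti subset_iff)
  have inj: "inj_on (\<lambda>i. P i x) I" using ip x by (intro inj_onI) (metis inner_eq_zero_iff)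
  have "pairwise orthogonal ?B" "0 \<notin> ?B"
    using ip x unfolding pairwise_def orthogonal_def by (auto, metis inner_eq_zero_iff inner_zero_left)
  hence ind: "independent ?B" by (rule pairwise_orthogonal_independent)
  show eq: "?N = span ?B"
  proof
    show "?N \<subseteq> span ?B" 
      by (clarify, erule sp_E, simp, intro span_sum span_scale span_base imageI)
    show "span ?B \<subseteq> ?N" by (rule span_minimal[OF _ sub]) (use P_in_sp fin in blast)
  qed
  show "dim ?N = card I" unfolding eq dim_span dim_eq_card_independent[OF ind] by (rule card_image[OF inj])
qed

lemma P_sp_anticommutator:
  assumes "I \<subseteq> {..m}" "j \<le> m"
  shows "P j (\<Sum>i\<in>I. a i *\<^sub>R P i x) + (\<Sum>i\<in>I. a i *\<^sub>R P i (P j x)) = (2 * (if j \<in> I then a j else 0)) *\<^sub>R x"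
proof -
  have fin: "finite I" using assms(1) finite_subset by blast
  have "P j (\<Sum>i\<in>I. a i *\<^sub>R P i x) = (\<Sum>i\<in>I. a i *\<^sub>R P j (P i x))"
    using linear_P[OF assms(2)] by (simp add: linear_sum linear_scale)
  hence "P j (\<Sum>i\<in>I. a i *\<^sub>R P i x) + (\<Sum>i\<in>I. a i *\<^sub>R P i (P j x)) = (\<Sum>i\<in>I. a i *\<^sub>R (P j (P i x) + P i (P j x)))"
    by (simp add: sum.distrib algebra_simps)
  also have "\<dots> = (\<Sum>i\<in>I. if i = j then (2 * a j) *\<^sub>R x else 0)"
  proof (intro sum.cong refl)
    fix i assume i: "i \<in> I"
    show "a i *\<^sub>R (P j (P i x) + P i (P j x)) = (if i = j then (2 * a j) *\<^sub>R x else 0)"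
    proof (cases "i = j")
      case True
      have "P j (P j x) + P j (P j x) = 2 *\<^sub>R x" using assms by (simp add: P_P scaleR_2)
      thus ?thesis using True by (simp add: mult.commute)
    next
      case False
      hence "P j (P i x) = - P i (P j x)" using assms i by (intro anti) auto
      thus ?thesis using False by simp
    qed
  qed
  also have "\<dots> = (2 * (if j \<in> I then a j else 0)) *\<^sub>R x"
    using fin by (simp add: sum.delta)
  finally show ?thesis .
qed

lemma sp_anticommutator_ex:
  assumes S: "S \<in> sp I" and T: "T \<in> sp I" and I: "I \<subseteq> {..m}"
  shows "\<exists>\<beta>. \<forall>x. S (T x) + T (S x) = \<beta> *\<^sub>R x"
proof -
  obtain a b where S': "S = (\<lambda>x. \<Sum>i\<in>I. a i *\<^sub>R P i x)" and T': "T = (\<lambda>x. \<Sum>i\<in>I. b i *\<^sub>R P i x)"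
    using S T by (auto simp: sp_def)
  have lT: "linear T" using linear_sp T I by blast
  have "S (T x) + T (S x) = (\<Sum>i\<in>I. 2 * a i * b i) *\<^sub>R x" for x
  proof -
    have "S (T x) + T (S x) = (\<Sum>i\<in>I. a i *\<^sub>R (P i (T x) + T (P i x)))"
      using lT unfolding S' by (simp add: linear_sum linear_scale sum.distrib algebra_simps)
    also have "\<dots> = (\<Sum>i\<in>I. (2 * a i * b i) *\<^sub>R x)"
      using P_sp_anticommutator[OF I, of _ b x] I unfolding T' by (intro sum.cong) (auto simp: subset_iff)
    finally show ?thesis by (simp add: scaleR_left.sum)
  qed
  thus ?thesis by blast
qed

text \<open>The anticommutator of \<open>S\<close> and \<open>T\<close> is read off their values at any one unit vector,
  so no coordinates of \<open>S\<close> and \<open>T\<close> are needed.\<close>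

lemma sp_anticommutator:
  assumes S: "S \<in> sp I" and T: "T \<in> sp I" and I: "I \<subseteq> {..m}" and p: "norm p = 1"
  shows "S (T x) + T (S x) = (2 * (S p \<bullet> T p)) *\<^sub>R x"
proof -
  from sp_anticommutator_ex[OF S T I] obtain \<beta> where "\<forall>x. S (T x) + T (S x) = \<beta> *\<^sub>R x" ..
  hence \<beta>: "S (T x) + T (S x) = \<beta> *\<^sub>R x" for x ..
  have "\<beta> = (\<beta> *\<^sub>R p) \<bullet> p" using p by (simp add: norm_eq_1)
  also have "\<dots> = S (T p) \<bullet> p + T (S p) \<bullet> p" 
    unfolding inner_add_left[symmetric] \<beta> ..
  also have "\<dots> = 2 * (S p \<bullet> T p)"
    using sym_sp[OF S I, of "T p" p] sym_sp[OF T I, of "S p" p] by (simp add: inner_commute)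
  finally show ?thesis unfolding \<beta> by (rule arg_cong)
qed

lemma sp_anticommute:
  assumes "S \<in> sp I" "T \<in> sp I" "I \<subseteq> {..m}" "norm p = 1" "S p \<bullet> T p = 0"
  shows "S (T x) = - T (S x)"
proof -
  have "S (T x) + T (S x) = 0" unfolding sp_anticommutator[OF assms(1-4), of x] assms(5) by simp
  thus ?thesis by (rule eq_neg_iff_add_eq_0[THEN iffD2])
qed

lemma sp_involution:
  assumes "T \<in> sp I" "I \<subseteq> {..m}" "norm p = 1" "norm (T p) = 1"
  shows "T (T x) = x"
proof -
  have 1: "T p \<bullet> T p = 1" using assms(4) unfolding norm_eq_1 .
  have "2 *\<^sub>R T (T x) = T (T x) + T (T x)" by (rule scaleR_2)
  also have "\<dots> = 2 *\<^sub>R x" unfolding sp_anticommutator[OF assms(1,1,2,3), of x] 1 by simp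
  finally show ?thesis unfolding scaleR_cancel_left by simp
qed

lemma P_sp_anticommute:
  assumes "T \<in> sp I" "I \<subseteq> {..m}" "j \<le> m" "j \<notin> I"
  shows "P j (T x) = - T (P j x)"
proof -
  obtain a where T: "T = (\<lambda>x. \<Sum>i\<in>I. a i *\<^sub>R P i x)" using assms by (auto simp: sp_def)
  have "P j (T x) + T (P j x) = 0"
    unfolding T P_sp_anticommutator[OF assms(2,3), of a x] using assms(4) by simp
  thus ?thesis by (rule eq_neg_iff_add_eq_0[THEN iffD2])
qed

section \<open>The quartic form \<open>q\<close> and its symmetries\<close>

definition q :: "'a \<Rightarrow> real" where "q x = (\<Sum>i=0..m. (P i x \<bullet> x)\<^sup>2)"

lemma q_nonneg: "q x \<ge> 0" unfolding q_def by (intro sum_nonneg) auto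

text \<open>For the \<open>T\<close> with coefficients \<open>P i x \<bullet> x\<close>,
  \<open>q x\<close> is both \<open>T x \<bullet> x\<close> and the square of
  \<open>norm (T x)\<close>; Cauchy-Schwarz then bounds \<open>q x\<close> by its own square
  root.\<close>

lemma q_le: "norm x = 1 \<Longrightarrow> q x \<le> 1"
proof -
  assume x: "norm x = 1"
  define T where "T = (\<lambda>y. \<Sum>i\<in>{0..m}. (P i x \<bullet> x) *\<^sub>R P i y)"
  have T: "T \<in> sp {0..m}" unfolding T_def by (rule sp_I)
  have 1: "T x \<bullet> x = q x" by (simp add: T_def q_def inner_sum_left power2_eq_square)
  have "T x \<bullet> T x = q x * (x \<bullet> x)"
    unfolding T_def q_def power2_eq_square by (rule inner_sp_sp) auto
  also have "\<dots> = q x" using x by (simp add: norm_eq_1)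
  finally have 2: "(norm (T x))\<^sup>2 = q x" by (simp add: power2_norm_eq_inner)
  have "q x \<le> norm (T x)" using norm_cauchy_schwarz[of "T x" x] 1 x by simp
  hence "(q x)\<^sup>2 \<le> (norm (T x))\<^sup>2" using q_nonneg by (intro power_mono)
  hence "q x * q x \<le> q x * 1" using 2 by (simp add: power2_eq_square)
  thus "q x \<le> 1" using q_nonneg[of x] by (cases "q x = 0") (auto simp: mult_le_cancel_left)
qed

lemma clifford_function_eq: "clifford_function m P x = 1 - 2 * q x"
  by (simp add: clifford_function_def q_def)

definition symm :: "('a \<Rightarrow> 'a) \<Rightarrow> bool" where
  "symm A \<longleftrightarrow> orthogonal_transformation A \<and> (\<forall>x. q (A x) = q x)"

lemma symm_comp: "symm A \<Longrightarrow> symm B \<Longrightarrow> symm (\<lambda>x. A (B x))"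
  unfolding symm_def using orthogonal_transformation_compose[of A B] by (auto simp: o_def)

lemma symm_inv: "symm A \<Longrightarrow> symm (inv A)"
  unfolding symm_def by (metis orthogonal_transformation_inv orthogonal_transformation_surj surj_f_inv_f)

lemma symm_uminus: "symm uminus"
proof -
  have "q (- x) = q x" for x unfolding q_def by (intro sum.cong) (auto simp: P_simps)
  thus ?thesis by (simp add: symm_def orthogonal_transformation_neg)
qed

lemma symm_stabilizer:
  assumes "symm A"
  shows "A \<in> orthogonal_stabilizer (clifford_hypersurface m P c)"
proof -
  have A: "orthogonal_transformation A" "\<And>x. q (A x) = q x" using assms by (auto simp: symm_def)
  have "A ` clifford_hypersurface m P c = clifford_hypersurface m P c"
  proof (intro set_eqI iffI)
    fix y assume y: "y \<in> clifford_hypersurface m P c"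
    obtain x where "y = A x" using orthogonal_transformation_surj[OF A(1)] by (metis surjD)
    thus "y \<in> A ` clifford_hypersurface m P c"
      using y A by (auto simp: clifford_hypersurface_def clifford_function_eq orthogonal_transformation_norm)
  qed (use A in \<open>auto simp: clifford_hypersurface_def clifford_function_eq orthogonal_transformation_norm\<close>)
  thus ?thesis using A(1) by (simp add: orthogonal_stabilizer_def)
qed

text \<open>Call the vector of the values \<open>P i x \<bullet> x\<close> the moment vector of
  \<open>x\<close>. A unit element with coefficients \<open>a\<close> acts on it as the half-turn
  about the axis \<open>a\<close>.\<close>

lemma reflection_formula:
  assumes T: "T = (\<lambda>x. \<Sum>i=0..m. a i *\<^sub>R P i x)" and i: "i \<le> m" and inv: "\<And>x. T (T x) = x"
  shows "P i (T x) \<bullet> T x = 2 * a i * (T x \<bullet> x) - P i x \<bullet> x"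
proof -
  have Tsp: "T \<in> sp {0..m}" unfolding T by (rule sp_I)
  have I: "{0..m} \<subseteq> {..m}" by auto
  have "P i (T x) = (2 * a i) *\<^sub>R x - T (P i x)"
    using P_sp_anticommutator[OF I i, of a x] i unfolding T by (simp add: algebra_simps)
  hence "P i (T x) \<bullet> T x = 2 * a i * (x \<bullet> T x) - T (P i x) \<bullet> T x" by (simp add: inner_diff_left)
  also have "T (P i x) \<bullet> T x = P i x \<bullet> x" using sym_sp[OF Tsp I] inv by simp
  finally show ?thesis by (simp add: inner_commute)
qed

text \<open>A half-turn is an isometry, so the moment vector keeps its length, whose square is
  \<open>q\<close>.\<close>

lemma symm_sp:
  assumes T: "T \<in> sp {0..m}" and p: "norm p = 1" "norm (T p) = 1"
  shows "symm T"
proof -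
  have I: "{0..m} \<subseteq> {..m}" by auto
  note inv = sp_involution[OF T I p]
  obtain a where T': "T = (\<lambda>x. \<Sum>i=0..m. a i *\<^sub>R P i x)" using T by (auto simp: sp_def)
  have "T x \<bullet> T y = x \<bullet> y" for x y using sym_sp[OF T I] inv by simp
  hence "orthogonal_transformation T" using linear_sp[OF T I] by (simp add: orthogonal_transformation_def)
  moreover have "q (T x) = q x" for x
  proof -
    define t where "t = T x \<bullet> x"
    have t: "t = (\<Sum>i=0..m. a i * (P i x \<bullet> x))" by (simp add: t_def T' inner_sum_left)
    have "1 = T p \<bullet> T p" using p by (simp add: norm_eq_1)
    also have "\<dots> = (\<Sum>i=0..m. a i * a i) * (p \<bullet> p)"
      unfolding T' by (rule inner_sp_sp[OF I])
    also have "\<dots> = (\<Sum>i=0..m. (a i)\<^sup>2)" using p(1) by (simp add: norm_eq_1 power2_eq_square)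
    finally have a: "(\<Sum>i=0..m. (a i)\<^sup>2) = 1" by simp
    have "q (T x) = (\<Sum>i=0..m. (2 * a i * t - P i x \<bullet> x)\<^sup>2)"
      unfolding q_def t_def using reflection_formula[OF T' _ inv] by (intro sum.cong) auto
    also have "\<dots> = (\<Sum>i=0..m. 4 * t\<^sup>2 * (a i)\<^sup>2 - 4 * t * (a i * (P i x \<bullet> x)) + (P i x \<bullet> x)\<^sup>2)"
      by (intro sum.cong) (auto simp: power2_eq_square algebra_simps)
    also have "\<dots> = 4 * t\<^sup>2 * (\<Sum>i=0..m. (a i)\<^sup>2) - 4 * t * t + q x"
      unfolding t q_def by (simp add: sum.distrib sum_subtractf sum_distrib_left)
    finally show ?thesis using a by (simp add: power2_eq_square)
  qed
  ultimately show ?thesis by (simp add: symm_def)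
qed

end

section \<open>Clifford systems of ten members in dimension 32\<close>

lemma exists_unit_orthogonal:
  fixes S :: "'a::euclidean_space set"
  assumes S: "subspace S" and B: "finite B" "B \<subseteq> S" "card B < dim S"
  obtains x where "x \<in> S" "norm x = 1" "\<And>b. b \<in> B \<Longrightarrow> x \<bullet> b = 0"
proof -
  have "dim B < dim S" using dim_le_card'[OF B(1)] B(3) by simp
  hence "span B \<subset> span S" using span_mono[OF B(2)] dim_span by (metis less_irrefl psubsetI)
  then obtain y where y: "y \<noteq> 0" "y \<in> span S" "\<And>z. z \<in> span B \<Longrightarrow> orthogonal y z"
    using orthogonal_to_subspace_exists_gen by blast
  show ?thesis
  proof (rule that)
    show "y /\<^sub>R norm y \<in> S" using y(2) S by (simp add: span_eq_iff[THEN iffD2] subspace_scale)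
    show "norm (y /\<^sub>R norm y) = 1" using y(1) by simp
    show "(y /\<^sub>R norm y) \<bullet> b = 0" if "b \<in> B" for b
      using y(3)[OF span_base[OF that]] by (simp add: orthogonal_def)
  qed
qed

locale clifford10 = clifford 9 P for P :: "nat \<Rightarrow> 'a::euclidean_space \<Rightarrow> 'a" +
  assumes dim32: "DIM('a) = 32"
begin

text \<open>Oriented for rewriting: words in the \<open>P i\<close> are sorted by increasing index,
  which turns identities between them into computations.\<close>

lemma P_swap: "i < j \<Longrightarrow> j \<le> 9 \<Longrightarrow> P j (P i x) = - P i (P j x)"
  by (rule anti) auto

text \<open>The volume element of \<open>P 1, \<dots>, P 8\<close>. Moving \<open>P 0\<close> or
  \<open>P 9\<close> past it costs eight signs, moving one of its own factors seven.\<close>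

definition eta :: "'a \<Rightarrow> 'a" where
  "eta x = P 1 (P 2 (P 3 (P 4 (P 5 (P 6 (P 7 (P 8 x)))))))"

lemma eta_eta: "eta (eta x) = x"
  by (simp add: eta_def P_swap P_P P_simps)

lemma eta_P0: "eta (P 0 x) = P 0 (eta x)" and eta_P9: "eta (P 9 x) = P 9 (eta x)"
  by (simp_all add: eta_def P_swap P_P P_simps)

lemma eta_P: "i \<in> {1..8} \<Longrightarrow> eta (P i x) = - P i (eta x)"
proof -
  assume "i \<in> {1..8}"
  hence "i = 1 \<or> i = 2 \<or> i = 3 \<or> i = 4 \<or> i = 5 \<or> i = 6 \<or> i = 7 \<or> i = 8" by auto
  thus ?thesis by (elim disjE) (simp_all add: eta_def P_swap P_P P_simps)
qed

lemma eta_sym: "eta x \<bullet> y = x \<bullet> eta y"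
proof -
  have "eta x \<bullet> y = x \<bullet> P 8 (P 7 (P 6 (P 5 (P 4 (P 3 (P 2 (P 1 y)))))))"
    by (simp add: eta_def sym)
  also have "P 8 (P 7 (P 6 (P 5 (P 4 (P 3 (P 2 (P 1 y))))))) = eta y"
    by (simp add: eta_def P_swap P_P P_simps)
  finally show ?thesis .
qed

lemma eta_linear: "linear eta"
  by (rule linearI) (simp_all add: eta_def P_simps)

lemmas eta_simps = linear_add[OF eta_linear] linear_diff[OF eta_linear] linear_neg[OF eta_linear]
  linear_scale[OF eta_linear] linear_0[OF eta_linear]

text \<open>\<open>E 1 1\<close> and \<open>E (-1) (-1)\<close> are the two half-spin representations of the \<open>Spin(8)\<close> generated by
  \<open>P 1, \<dots>, P 8\<close>.\<close>

definition E :: "real \<Rightarrow> real \<Rightarrow> 'a set" where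
  "E a b = {x. P 0 x = a *\<^sub>R x \<and> eta x = b *\<^sub>R x}"

lemma subspace_E: "subspace (E a b)"
  by (simp add: subspace_def E_def P_simps eta_simps algebra_simps)

lemma dim_E:
  assumes a: "a = 1 \<or> a = -1" and b: "b = 1 \<or> b = -1"
  shows "dim (E a b) = 8"
proof -
  have "2 * dim {x \<in> UNIV. P 0 x = a *\<^sub>R x} = dim (UNIV :: 'a set)"
    by (rule dim_eigenspace_involution[where S = "P 1"])
       (use a in \<open>auto simp: linear_P P_P P_swap intro!: inj_on_inverseI[of _ "P 1"]\<close>)
  hence 1: "dim {x. P 0 x = a *\<^sub>R x} = 16" using dim32 by simp
  \<comment> \<open>\<open>P 1\<close> alone would leave the eigenspace of \<open>P 0\<close>. The
    even product of \<open>P 1\<close> and \<open>P 9\<close> preserves it, and it anticommutes with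
    \<open>eta\<close> because only one of the two factors does.\<close>
  have "2 * dim {x \<in> {x. P 0 x = a *\<^sub>R x}. eta x = b *\<^sub>R x} = dim {x. P 0 x = a *\<^sub>R x}"
  proof (rule dim_eigenspace_involution[where S = "\<lambda>x. P 1 (P 9 x)"])
    show "subspace {x. P 0 x = a *\<^sub>R x}" by (simp add: subspace_def P_simps algebra_simps)
    show "linear (\<lambda>x. P 1 (P 9 x))" by (rule linearI) (simp_all add: P_simps)
    show "inj_on (\<lambda>x. P 1 (P 9 x)) {x. P 0 x = a *\<^sub>R x}"
      by (rule inj_on_inverseI[of _ "\<lambda>x. P 9 (P 1 x)"]) (simp add: P_P)
  next
    fix x assume x: "x \<in> {x. P 0 x = a *\<^sub>R x}"
    have "P 0 (P 1 (P 9 x)) = P 1 (P 9 (P 0 x))" by (simp add: P_swap P_simps)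
    thus "P 1 (P 9 x) \<in> {x. P 0 x = a *\<^sub>R x}" using x by (simp add: P_simps)
    show "eta x \<in> {x. P 0 x = a *\<^sub>R x}" using x by (simp add: eta_P0[symmetric] eta_simps)
  qed (use b in \<open>auto simp: eta_eta eta_P eta_P9 eta_linear\<close>)
  moreover have "{x \<in> {x. P 0 x = a *\<^sub>R x}. eta x = b *\<^sub>R x} = E a b" by (auto simp: E_def)
  ultimately show ?thesis using 1 by simp
qed

section \<open>Clifford products between the half-spin representations\<close>

lemma le8: "{1..8} \<subseteq> {..9::nat}" by auto

abbreviation "W \<equiv> sp {1..8}"

lemma P8_W: "P 8 \<in> W" by (rule P_in_sp) auto

lemma W_P0: "T \<in> W \<Longrightarrow> P 0 (T x) = - T (P 0 x)"
  and W_P9: "T \<in> W \<Longrightarrow> P 9 (T x) = - T (P 9 x)"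
  by (rule P_sp_anticommute[OF _ le8]; simp)+

lemma W_eta: "T \<in> W \<Longrightarrow> eta (T x) = - T (eta x)"
proof (elim sp_E)
  fix a assume T: "T = (\<lambda>x. \<Sum>i\<in>{1..8}. a i *\<^sub>R P i x)"
  have "eta (T x) = (\<Sum>i\<in>{1..8}. a i *\<^sub>R eta (P i x))"
    unfolding T by (simp add: linear_sum[OF eta_linear] eta_simps)
  also have "\<dots> = (\<Sum>i\<in>{1..8}. - (a i *\<^sub>R P i (eta x)))"
    by (intro sum.cong refl) (simp add: eta_P)
  finally show "eta (T x) = - T (eta x)" unfolding T by (simp add: sum_negf)
qed

lemma W_E: "T \<in> W \<Longrightarrow> x \<in> E a b \<Longrightarrow> T x \<in> E (- a) (- b)"
  by (simp add: E_def W_P0 W_eta sp_simps[OF _ le8])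

text \<open>Evaluation at \<open>p\<close> embeds the eight dimensions of \<open>W\<close> into a
  space of dimension eight.\<close>

lemma W_transitive:
  assumes p: "p \<in> E 1 1" "p \<noteq> 0" and z: "z \<in> E (-1) (-1)"
  obtains T where "T \<in> W" "T p = z"
proof -
  have "{T p |T. T \<in> W} \<subseteq> E (-1) (-1)" using W_E p(1) by auto
  moreover have "dim (E (-1) (-1)) \<le> dim {T p |T. T \<in> W}" by (simp add: sp_image(2)[OF le8 p(2)] dim_E del: One_nat_def)
  ultimately have "{T p |T. T \<in> W} = E (-1) (-1)"
    using subspace_dim_equal[OF sp_image(1)[OF le8 p(2)] subspace_E] by blast
  hence "z \<in> {T p |T. T \<in> W}" using z by simp
  thus ?thesis using that by (elim CollectE exE conjE) simp
qed

text \<open>If \<open>E 1 1\<close> is identified with the octonions and \<open>p\<close> with \<open>1\<close>, the map \<open>- P 8 \<circ> C \<circ> U \<circ> B\<close> is the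
  automorphism that is the identity on the quaternion subalgebra generated by
  \<open>P 8 (U p)\<close> and \<open>P 8 (B p)\<close> and minus the identity on its orthogonal complement.\<close>

lemma stabilizer_transitive:
  assumes p: "p \<in> E 1 1" "norm p = 1"
    and s: "s \<in> E 1 1" "s \<bullet> p = 0" and s': "s' \<in> E 1 1" "s' \<bullet> p = 0" and norm: "norm s = norm s'"
  obtains C U B where "C \<in> W" "U \<in> W" "B \<in> W" "norm (C p) = 1" "norm (U p) = 1" "norm (B p) = 1"
    "P 8 (C (U (B p))) = - p" "P 8 (C (U (B s))) = - s'"
proof -
  note sE = subspace_E[of 1 1]
  have d8: "dim (E 1 1) = 8" by (simp add: dim_E)
  \<comment> \<open>With \<open>s + s'\<close> a multiple of a unit vector \<open>u\<close>
    orthogonal to \<open>d\<close>, it suffices, up to a common sign, to fix \<open>p\<close> and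
    \<open>u\<close> and to negate \<open>d\<close>: this exchanges \<open>s\<close> and
    \<open>s'\<close>.\<close>
  define d where "d = s - s'"
  have dE: "d \<in> E 1 1" and dp: "d \<bullet> p = 0"
    using s s' sE by (auto simp: d_def subspace_diff inner_diff_left)
  have orth: "(s + s') \<bullet> d = 0"
    using norm unfolding d_def by (simp add: algebra_simps inner_commute norm_eq)
  obtain u \<kappa> where u: "u \<in> E 1 1" "norm u = 1" "u \<bullet> p = 0" "u \<bullet> d = 0" and \<kappa>: "s + s' = \<kappa> *\<^sub>R u"
  proof (cases "s + s' = 0")
    case True
    have "card {p, d} < dim (E 1 1)" using d8 card_insert_le_m1[of 2 "{d}" p] by (simp add: card_insert_if)
    then obtain u where "u \<in> E 1 1" "norm u = 1" "\<And>b. b \<in> {p, d} \<Longrightarrow> u \<bullet> b = 0"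
      using exists_unit_orthogonal[OF sE, of "{p, d}"] p dE by blast
    thus ?thesis using that[of u 0] True by auto
  next
    case False
    show ?thesis
    proof (rule that[of "(s + s') /\<^sub>R norm (s + s')" "norm (s + s')"])
      show "(s + s') /\<^sub>R norm (s + s') \<in> E 1 1" using sE s s' by (intro subspace_scale subspace_add) auto
      show "((s + s') /\<^sub>R norm (s + s')) \<bullet> p = 0" using s s' by (simp add: inner_add_left)
    qed (use False orth in auto)
  qed
  have p0: "p \<noteq> 0" using p by auto
  have P8E: "P 8 x \<in> E (-1) (-1)" if "x \<in> E 1 1" for x using W_E[OF P8_W that] by simp
  obtain U where U: "U \<in> W" "U p = P 8 u" using W_transitive[OF p(1) p0 P8E[OF u(1)]] .
  obtain V where V: "V \<in> W" "V p = P 8 d" using W_transitive[OF p(1) p0 P8E[OF dE]] .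
  have UW: "U (T p) \<in> E 1 1" if "T \<in> W" for T using W_E[OF U(1) W_E[OF that p(1)]] by simp
  \<comment> \<open>Orthogonality of \<open>y\<close> to \<open>p\<close>, \<open>u\<close>,
    \<open>d\<close> makes \<open>B\<close> anticommute with \<open>P 8\<close>, \<open>U\<close>,
    \<open>V\<close>; orthogonality to \<open>U (V p)\<close> makes \<open>C\<close> anticommute
    with \<open>V\<close>.\<close>
  have "card {p, u, d, U (V p)} \<le> 4" by (simp add: card_insert_if)
  hence "card {p, u, d, U (V p)} < dim (E 1 1)" using d8 by simp
  moreover have "{p, u, d, U (V p)} \<subseteq> E 1 1" using p u dE UW[OF V(1)] by auto
  ultimately obtain y where y: "y \<in> E 1 1" "norm y = 1" "\<And>b. b \<in> {p, u, d, U (V p)} \<Longrightarrow> y \<bullet> b = 0"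
    using exists_unit_orthogonal[OF sE, of "{p, u, d, U (V p)}"] by blast
  obtain B where B: "B \<in> W" "B p = P 8 y" using W_transitive[OF p(1) p0 P8E[OF y(1)]] .
  \<comment> \<open>\<open>C\<close> imitates the product of \<open>P 8\<close>, \<open>U\<close>
    and \<open>B\<close> at \<open>p\<close>, so that the product of all four sends \<open>p\<close>
    to \<open>- p\<close>.\<close>
  obtain C where C: "C \<in> W" "C p = P 8 (U (B p))" using W_transitive[OF p(1) p0 P8E[OF UW[OF B(1)]]] .
  note ac = sp_anticommute[OF _ _ le8 p(2)]
  note sy = sym_sp[OF _ le8]
  have n: "norm (U p) = 1" "norm (B p) = 1" using U B u y by (auto simp: norm_P)
  note inv = sp_involution[OF _ le8 p(2)]
  have UU: "U (U x) = x" and BB: "B (B x) = x" for x using inv U(1) B(1) n by auto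
  have PP: "P 8 (P 8 x) = x" for x by (simp add: P_P)
  have P8s: "P 8 x \<bullet> z = x \<bullet> P 8 z" for x z by (simp add: sym)
  have UP: "U (P 8 x) = - P 8 (U x)" for x
    using U(2) u(3) by (intro ac U(1) P8_W) (simp add: P8s PP)
  have VP: "V (P 8 x) = - P 8 (V x)" for x
    using V(2) dp by (intro ac V(1) P8_W) (simp add: P8s PP)
  have BP: "B (P 8 x) = - P 8 (B x)" for x
    using B(2) y(3)[of p] by (intro ac B(1) P8_W) (simp add: P8s PP)
  have VU: "V (U x) = - U (V x)" for x
    using U(2) V(2) u(4) by (intro ac U(1) V(1)) (simp add: P8s PP inner_commute)
  have BU: "B (U x) = - U (B x)" for x
    using U(2) B(2) y(3)[of u] by (intro ac U(1) B(1)) (simp add: P8s PP)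
  have VB: "V (B x) = - B (V x)" for x
    using V(2) B(2) y(3)[of d] by (intro ac V(1) B(1)) (simp add: P8s PP inner_commute)
  have Us: "U x \<bullet> z = x \<bullet> U z" and Bs: "B x \<bullet> z = x \<bullet> B z" for x z using sy U(1) B(1) by auto
  have CP: "C (P 8 x) = - P 8 (C x)" for x
  proof (intro ac C(1) P8_W)
    have "C p \<bullet> P 8 p = B p \<bullet> U p" unfolding C(2) by (simp add: P8s PP Us)
    also have "\<dots> = 0" using U(2) B(2) y(3)[of u] by (simp add: P8s PP)
    finally show "C p \<bullet> P 8 p = 0" .
  qed
  have CU: "C (U x) = - U (C x)" for x
  proof (intro ac C(1) U(1))
    have "C p \<bullet> U p = - (U (B p) \<bullet> U (P 8 p))" unfolding C(2) P8s by (simp add: UP)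
    also have "\<dots> = - (B p \<bullet> P 8 p)" by (simp add: Us UU)
    also have "\<dots> = 0" using B(2) y(3)[of p] by (simp add: P8s PP)
    finally show "C p \<bullet> U p = 0" .
  qed
  have CB: "C (B x) = - B (C x)" for x
  proof (intro ac C(1) B(1))
    have "C p \<bullet> B p = B (U p) \<bullet> B (P 8 p)" unfolding C(2) P8s by (simp add: BP BU)
    also have "\<dots> = U p \<bullet> P 8 p" by (simp add: Bs BB)
    also have "\<dots> = 0" using U(2) u(3) by (simp add: P8s PP)
    finally show "C p \<bullet> B p = 0" .
  qed
  have CV: "C (V x) = - V (C x)" for x
  proof (intro ac C(1) V(1))
    have "C p \<bullet> V p = B p \<bullet> U (P 8 (V p))" unfolding C(2) by (simp add: P8s Us)
    also have "\<dots> = - (y \<bullet> U (V p))" unfolding B(2) by (simp add: P8s UP PP)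
    also have "\<dots> = 0" using y(3)[of "U (V p)"] by simp
    finally show "C p \<bullet> V p = 0" .
  qed
  have nC: "norm (C p) = 1" unfolding C(2) using n(2) by (simp add: norm_P norm_eq_1 Us UU)
  have CC: "C (C x) = x" for x using inv C(1) nC by auto
  note lin = sp_simps[OF U(1) le8] sp_simps[OF B(1) le8] sp_simps[OF C(1) le8] sp_simps[OF V(1) le8] P_simps[of 8, simplified]
  note rules = UP VP BP VU BU VB CP CU CB CV UU BB PP CC lin C(2)
  have gp: "P 8 (C (U (B p))) = - p" by (simp add: rules)
  \<comment> \<open>The product of the four anticommutes with each of its factors and commutes with
    \<open>V\<close>. Since \<open>u = P 8 (U p)\<close> involves two factors and
    \<open>d = P 8 (V p)\<close> one, \<open>u\<close> follows the sign of \<open>p\<close> and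
    \<open>d\<close> takes the opposite one.\<close>
  have "P 8 (C (U (B (P 8 (U p))))) = - P 8 (U p)" by (simp add: rules)
  hence gu: "P 8 (C (U (B u))) = - u" unfolding U(2) PP .
  have "P 8 (C (U (B (P 8 (V p))))) = P 8 (V p)" by (simp add: rules)
  hence gd: "P 8 (C (U (B d))) = d" unfolding V(2) PP .
  have "s = (1/2) *\<^sub>R (\<kappa> *\<^sub>R u + d)" unfolding \<kappa>[symmetric] d_def by (simp add: scaleR_2[symmetric])
  hence "P 8 (C (U (B s))) = (1/2) *\<^sub>R (\<kappa> *\<^sub>R P 8 (C (U (B u))) + P 8 (C (U (B d))))" by (simp add: lin)
  also have "\<dots> = - ((1/2) *\<^sub>R (\<kappa> *\<^sub>R u - d))" unfolding gu gd by (simp add: algebra_simps)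
  also have "\<dots> = - s'" unfolding \<kappa>[symmetric] d_def by (simp add: scaleR_2[symmetric])
  finally show ?thesis using that[OF C(1) U(1) B(1) nC n gp] by simp
qed

end

section \<open>Transitivity on the level sets\<close>

context clifford
begin

text \<open>The half-turn argument restricted to the components in \<open>I\<close>: a vanishing
  moment vector stays zero.\<close>

lemma sp_isotropic_step:
  assumes T: "T \<in> sp I" and I: "I \<subseteq> {..m}" and p: "norm p = 1" "norm (T p) = 1"
    and z: "\<And>S. S \<in> sp I \<Longrightarrow> S z \<bullet> z = 0" and S: "S \<in> sp I"
  shows "S (T z) \<bullet> T z = 0"
proof -
  have "S (T z) = (2 * (S p \<bullet> T p)) *\<^sub>R z - T (S z)"
    using sp_anticommutator[OF S T I p(1), of z] by (metis add_diff_cancel_right')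
  moreover have "T (S z) \<bullet> T z = S z \<bullet> z"
    using sym_sp[OF T I, of "S z" "T z"] sp_involution[OF T I p] by simp
  ultimately have "S (T z) \<bullet> T z = 2 * (S p \<bullet> T p) * (z \<bullet> T z) - S z \<bullet> z"
    by (simp add: inner_diff_left)
  thus ?thesis using z[OF T] z[OF S] by (simp add: inner_commute)
qed

lemma norm_sp_unit:
  assumes "T \<in> sp I" "I \<subseteq> {..m}" "norm p = 1" "norm (T p) = 1"
  shows "norm (T x) = norm x"
  using sym_sp[OF assms(1,2)] sp_involution[OF assms] by (simp add: norm_eq)

lemma symm_sp':
  assumes "T \<in> sp I" "I \<subseteq> {..m}" "norm p = 1" "norm (T p) = 1"
  shows "symm T"
proof (rule symm_sp)
  show "T \<in> sp {0..m}" using sp_mono[of I "{0..m}"] assms(1,2) by (auto simp: atMost_atLeast0)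
qed (use assms in auto)

text \<open>The half-turn about the bisector of the moment vector and the direction of
  \<open>P 0\<close> carries the one into the other.\<close>

lemma rotate_to_axis:
  assumes m: "m > 0" and r: "r > 0" "q x = r\<^sup>2"
  obtains A where "symm A" "P 0 (A x) \<bullet> A x = r" "\<And>i. 0 < i \<Longrightarrow> i \<le> m \<Longrightarrow> P i (A x) \<bullet> A x = 0"
proof -
  note found = that
  define b where "b = (\<lambda>i. P i x \<bullet> x)"
  have "x \<noteq> 0" using r by (auto simp: q_def P_simps)
  hence "norm (x /\<^sub>R norm x) = 1" by simp
  then obtain p :: 'a where p: "norm p = 1" by blast
  have I: "{0..m} \<subseteq> {..m}" by auto
  have bb: "(\<Sum>i=0..m. b i * b i) = r\<^sup>2" using r(2) by (simp add: q_def b_def power2_eq_square)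
  have main: thesis if a: "(\<Sum>i=0..m. a i * a i) = 1"
    and ab: "\<And>i. i \<le> m \<Longrightarrow> 2 * a i * (\<Sum>j=0..m. a j * b j) - b i = (if i = 0 then r else 0)" for a
  proof -
    define T where "T = (\<lambda>x. \<Sum>i=0..m. a i *\<^sub>R P i x)"
    have T: "T \<in> sp {0..m}" unfolding T_def by (rule sp_I)
    have "T p \<bullet> T p = 1" unfolding T_def inner_sp_sp[OF I] a using p by (simp add: norm_eq_1)
    hence Tp: "norm (T p) = 1" by (simp add: norm_eq_1)
    have Tx: "T x \<bullet> x = (\<Sum>j=0..m. a j * b j)" by (simp add: T_def b_def inner_sum_left)
    have "P i (T x) \<bullet> T x = (if i = 0 then r else 0)" if "i \<le> m" for i
      using reflection_formula[OF T_def that sp_involution[OF T I p Tp], of x] ab[OF that]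
      by (simp add: Tx b_def)
    thus thesis using found[OF symm_sp[OF T p Tp]] by simp
  qed
  show thesis
  proof (cases "b 0 = - r")
    \<comment> \<open>For opposite directions there is no bisector, but a half-turn about any
      orthogonal axis negates the moment vector; \<open>m > 0\<close> provides the axis of
      \<open>P 1\<close>.\<close>
    case True
    have "(\<Sum>i=0..m. b i * b i) = b 0 * b 0 + (\<Sum>i=1..m. b i * b i)"
      by (simp add: sum.atLeast_Suc_atMost)
    hence "(\<Sum>i=1..m. b i * b i) = 0" using bb True by (simp add: power2_eq_square)
    hence 0: "\<forall>i\<in>{1..m}. b i * b i = 0" by (subst (asm) sum_nonneg_eq_0_iff) auto
    have d: "(if i = 1 then 1 else 0) * c = (if i = 1 then c else 0)" for i :: nat and c :: real by simp
    have "b 1 = 0" using 0 m by auto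
    show thesis
    proof (rule main[of "\<lambda>i. if i = 1 then 1 else 0"])
      show "(\<Sum>i=0..m. (if i = 1 then 1 else 0) * (if i = 1 then 1 else 0 :: real)) = 1"
        using m unfolding d by (simp add: sum.delta)
      fix i assume "i \<le> m"
      have "(\<Sum>j=0..m. (if j = 1 then 1 else 0) * b j) = b 1" using m unfolding d by (simp add: sum.delta)
      thus "2 * (if i = 1 then 1 else 0) * (\<Sum>j=0..m. (if j = 1 then 1 else 0) * b j) - b i = (if i = 0 then r else 0)"
        using \<open>b 1 = 0\<close> 0 True \<open>i \<le> m\<close> by auto
    qed
  next
    case False
    \<comment> \<open>\<open>w\<close> is the bisector before normalization, \<open>n\<close> its
      squared length.\<close>
    define w where "w = (\<lambda>i. b i + (if i = 0 then r else 0))"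
    have "b 0 * b 0 \<le> (\<Sum>i=0..m. b i * b i)"
      by (rule member_le_sum[where f = "\<lambda>i. b i * b i"]) auto
    hence "(b 0)\<^sup>2 \<le> r\<^sup>2" unfolding bb by (simp add: power2_eq_square)
    hence "\<bar>b 0\<bar> \<le> r" using r(1) by (simp add: abs_le_square_iff[symmetric])
    hence pos: "r + b 0 > 0" using False by auto
    define n where "n = 2 * r * (r + b 0)"
    have n: "n > 0" using pos r by (simp add: n_def)
    have ww: "(\<Sum>i=0..m. w i * w i) = n"
    proof -
      have "(\<Sum>i=0..m. w i * w i) = (\<Sum>i=0..m. b i * b i + (if i = 0 then 2 * r * b 0 + r\<^sup>2 else 0))"
        by (intro sum.cong) (auto simp: w_def power2_eq_square algebra_simps)
      also have "\<dots> = n" unfolding sum.distrib bb by (simp add: n_def power2_eq_square algebra_simps)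
      finally show ?thesis .
    qed
    have wb: "(\<Sum>i=0..m. w i * b i) = n / 2"
    proof -
      have "(\<Sum>i=0..m. w i * b i) = (\<Sum>i=0..m. b i * b i + (if i = 0 then r * b 0 else 0))"
        by (intro sum.cong) (auto simp: w_def algebra_simps)
      also have "\<dots> = n / 2" unfolding sum.distrib bb by (simp add: n_def power2_eq_square algebra_simps)
      finally show ?thesis .
    qed
    show thesis
    proof (rule main[of "\<lambda>i. w i / sqrt n"])
      have "(\<Sum>i=0..m. w i / sqrt n * (w i / sqrt n)) = (\<Sum>i=0..m. w i * w i) / n"
        using n by (simp add: sum_divide_distrib)
      thus "(\<Sum>i=0..m. w i / sqrt n * (w i / sqrt n)) = 1" using n ww by simp
      fix i assume "i \<le> m"
      have "(\<Sum>j=0..m. w j / sqrt n * b j) = n / 2 / sqrt n"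
        unfolding wb[symmetric] by (simp add: sum_divide_distrib)
      hence "2 * (w i / sqrt n) * (\<Sum>j=0..m. w j / sqrt n * b j) = w i * (n / (sqrt n * sqrt n))" by simp
      also have "\<dots> = w i" using n by simp
      finally show "2 * (w i / sqrt n) * (\<Sum>j=0..m. w j / sqrt n * b j) - b i = (if i = 0 then r else 0)"
        by (simp add: w_def)
    qed
  qed
qed

end

context clifford10
begin

section \<open>Reduction to a normal form\<close>

lemma le9: "{1..9} \<subseteq> {..9::nat}" by auto

lemma W_sub: "W \<subseteq> sp {1..9}" by (rule sp_mono) auto

text \<open>Unit vectors whose moment vector is \<open>r\<close> times the direction of
  \<open>P 0\<close>; quantifying over all of \<open>sp {1..9}\<close> avoids coordinates.\<close>

definition aligned :: "real \<Rightarrow> 'a \<Rightarrow> bool" where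
  "aligned r x \<longleftrightarrow> norm x = 1 \<and> P 0 x \<bullet> x = r \<and> (\<forall>S\<in>sp {1..9}. S x \<bullet> x = 0)"

text \<open>\<open>T\<close> anticommutes with \<open>P 0\<close>, so it reverses the axis; products
  of two such elements preserve it.\<close>

lemma aligned_step:
  assumes x: "aligned r x" and T: "T \<in> sp {1..9}" and p: "norm p = 1" "norm (T p) = 1"
  shows "aligned (- r) (T x)"
proof -
  note a = T le9 p
  have "P 0 (T x) \<bullet> T x = - (T (P 0 x) \<bullet> T x)" by (subst P_sp_anticommute[OF T le9]) auto
  also have "\<dots> = - r" using x sym_sp[OF T le9] sp_involution[OF a] by (simp add: aligned_def)
  finally show ?thesis
    using x norm_sp_unit[OF a] sp_isotropic_step[OF a, of x] by (simp add: aligned_def)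
qed

definition pos where "pos x = (1/2) *\<^sub>R (x + P 0 x)"
definition neg where "neg x = (1/2) *\<^sub>R (x - P 0 x)"

lemma pos_neg: "x = pos x + neg x"
  by (simp add: pos_def neg_def algebra_simps flip: scaleR_add_left)

lemma P0_pos: "P 0 (pos x) = pos x" and P0_neg: "P 0 (neg x) = - neg x"
  by (simp_all add: pos_def neg_def P_simps P_P algebra_simps)

lemma P0_orth: "P 0 x = x \<Longrightarrow> P 0 y = - y \<Longrightarrow> x \<bullet> y = 0"
  using sym[of 0 x y] by simp

lemma pos_even:
  assumes "S \<in> sp {1..9}" "T \<in> sp {1..9}"
  shows "pos (S (T x)) = S (T (pos x))"
  using assms by (simp add: pos_def P_sp_anticommute[OF _ le9] sp_simps[OF _ le9])

lemma norm_pos: "aligned r x \<Longrightarrow> (norm (pos x))\<^sup>2 = (1 + r) / 2"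
  and norm_neg: "aligned r x \<Longrightarrow> (norm (neg x))\<^sup>2 = (1 - r) / 2"
  unfolding power2_norm_eq_inner
  by (auto simp: pos_def neg_def aligned_def inner_add_left inner_add_right inner_diff_left inner_diff_right
      inner_P_P norm_eq_1 inner_commute)

text \<open>Split \<open>pos x = u + v\<close> by \<open>eta\<close>. If \<open>C u = P 9 v\<close>,
  then \<open>pos x\<close> is \<open>1 - C \<circ> P 9\<close> applied to \<open>u\<close>. For
  \<open>T = P 9 + C\<close>, the product \<open>T \<circ> P 9\<close> is
  \<open>1 + C \<circ> P 9\<close>, which cancels that factor up to a positive scalar and leaves a
  multiple of \<open>u\<close>.\<close>

lemma pos_into_E:
  obtains T p where "T \<in> sp {1..9}" "norm p = 1" "norm (T p) = 1" "T (P 9 (pos x)) \<in> E 1 1"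
proof -
  define u where "u = (1/2) *\<^sub>R (pos x + eta (pos x))"
  define v where "v = (1/2) *\<^sub>R (pos x - eta (pos x))"
  have uv: "pos x = u + v" by (simp add: u_def v_def algebra_simps flip: scaleR_add_left)
  have u: "u \<in> E 1 1" and v: "P 0 v = v" "eta v = - v"
    by (simp_all add: E_def u_def v_def eta_simps eta_eta P_simps eta_P0[symmetric] P0_pos algebra_simps)
  obtain p where "p \<in> E 1 1" and p: "norm p = 1"
    using exists_unit_orthogonal[OF subspace_E, of "{}" 1 1] by (auto simp: dim_E)
  have P9: "P 9 (P 9 x) = x" for x by (simp add: P_P)
  show thesis
  proof (cases "u = 0")
    case True
    have "P 0 (P 1 (P 9 v)) = P 1 (P 9 (P 0 v))" by (simp add: P_swap P_simps)
    moreover have "eta (P 1 (P 9 v)) = P 1 (P 9 v)" by (simp add: eta_P eta_P9 v P_simps)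
    ultimately have "P 1 (P 9 (pos x)) \<in> E 1 1" using True v by (simp add: uv E_def)
    moreover have "P 1 \<in> sp {1..9}" by (rule P_in_sp) auto
    ultimately show thesis using that[of "P 1" p] p by (simp add: norm_P)
  next
    case False
    have "P 0 (P 9 v) = - P 9 (P 0 v)" by (simp add: P_swap)
    hence "P 9 v \<in> E (-1) (-1)" using v by (simp add: E_def eta_P9 P_simps)
    then obtain C where C: "C \<in> W" "C u = P 9 v" using W_transitive[OF u False] by blast
    have Csp: "C \<in> sp {1..9}" using C W_sub by blast
    have P9sp: "P 9 \<in> sp {1..9}" by (rule P_in_sp) auto
    define T where "T = (\<lambda>x. P 9 x + C x)"
    have T: "T \<in> sp {1..9}" unfolding T_def by (rule sp_add[OF P9sp Csp])
    have *: "P 9 v = C u" "P 9 (C u) = v" using C(2) P9[of v] by simp_all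
    have "C (C u) + C (C u) = (2 * (C p \<bullet> C p)) *\<^sub>R u" by (rule sp_anticommutator[OF C(1,1) le8 p])
    hence CC: "C (C u) = (C p \<bullet> C p) *\<^sub>R u"
      by (metis (no_types) scaleR_2 scaleR_cancel_left scaleR_scaleR zero_neq_numeral)
    have "T (P 9 (pos x)) = u + P 9 (C u) + (C (P 9 u) + C (C u))"
      unfolding uv T_def by (simp add: P_simps sp_simps[OF Csp le9] * P9)
    also have "\<dots> = u + (C p \<bullet> C p) *\<^sub>R u" using W_P9[OF C(1), of u] by (simp add: CC)
    finally have Tu: "T (P 9 (pos x)) = (1 + C p \<bullet> C p) *\<^sub>R u" by (simp add: algebra_simps)
    have "T p \<bullet> P 9 p = p \<bullet> p + C p \<bullet> P 9 p" by (simp add: T_def inner_add_left inner_P_P)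
    moreover have "C p \<bullet> P 9 p = 0"
      using sym_sp[OF C(1) le8, of p "P 9 p"] sym[of 9 p "C p"] W_P9[OF C(1), of p]
      by (simp add: inner_commute)
    ultimately have "T p \<bullet> P 9 p = 1" using p by (simp add: norm_eq_1)
    hence N: "norm (T p) > 0" by auto
    have "T (P 9 (pos x)) /\<^sub>R norm (T p) \<in> E 1 1" unfolding Tu by (intro subspace_scale subspace_E u)
    thus thesis using that[OF sp_scale[OF T, of "inverse (norm (T p))"] p] N by simp
  qed
qed

text \<open>Each \<open>T\<close> in \<open>sp {1..9}\<close> exchanges the eigenspaces of
  \<open>P 0\<close>, so only the cross term of \<open>T x \<bullet> x = 0\<close> survives and
  \<open>neg x\<close> is orthogonal to \<open>T p\<close>. For \<open>T\<close> in \<open>W\<close>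
  these vectors fill \<open>E (-1) (-1)\<close>; \<open>T = P 9\<close> gives the second
  claim.\<close>

lemma aligned_neg:
  assumes x: "aligned r x" and p: "p \<in> E 1 1" "norm p = 1" and l: "pos x = l *\<^sub>R p" "l > 0"
  shows "P 9 (neg x) \<in> E 1 1" "P 9 (neg x) \<bullet> p = 0"
proof -
  have P0p: "P 0 p = p" using p by (simp add: E_def)
  have *: "T p \<bullet> neg x = 0" if T: "T \<in> sp {1..9}" for T
  proof -
    note TP = P_sp_anticommute[OF T le9, of 0]
    note Tl = sp_simps[OF T le9]
    have 1: "P 0 (T p) = - T p" using TP[of p] P0p by simp
    have "T p \<bullet> p = 0" using P0_orth[OF P0p 1] by (simp add: inner_commute)
    moreover have "P 0 (T (neg x)) = T (neg x)" using TP[of "neg x"] P0_neg[of x] by (simp add: Tl)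
    hence "T (neg x) \<bullet> neg x = 0" by (rule P0_orth) (rule P0_neg)
    moreover have "T (neg x) \<bullet> p = T p \<bullet> neg x" using sym_sp[OF T le9, of p "neg x"] by (simp add: inner_commute)
    moreover have "T x \<bullet> x = 0" using x T by (simp add: aligned_def)
    hence "T (l *\<^sub>R p + neg x) \<bullet> (l *\<^sub>R p + neg x) = 0" using pos_neg[of x] l by simp
    ultimately have "2 * (l * (T p \<bullet> neg x)) = 0"
      by (simp add: Tl inner_add_left inner_add_right inner_commute)
    thus ?thesis using l by simp
  qed
  \<comment> \<open>\<open>k\<close> is the orthogonal projection of \<open>neg x\<close> to
    \<open>E (-1) (-1)\<close>, so \<open>k \<bullet> k = k \<bullet> neg x\<close>.\<close>
  define k where "k = (1/2) *\<^sub>R (neg x - eta (neg x))"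
  have "k \<in> E (-1) (-1)"
    by (simp add: k_def E_def P_simps eta_simps eta_eta P0_neg eta_P0[symmetric] algebra_simps)
  moreover have "p \<noteq> 0" using p by auto
  ultimately obtain T where "T \<in> W" "T p = k" using W_transitive[OF p(1)] by blast
  hence "k \<bullet> neg x = 0" using * W_sub by blast
  moreover have "eta (neg x) \<bullet> eta (neg x) = neg x \<bullet> neg x" by (simp add: eta_sym eta_eta)
  ultimately have "k \<bullet> k = 0"
    by (simp add: k_def inner_diff_left inner_diff_right inner_commute)
  hence "eta (neg x) = neg x" by (simp add: k_def)
  thus "P 9 (neg x) \<in> E 1 1" by (simp add: E_def eta_P9 anti[of 9 0] P0_neg P_simps)
  show "P 9 (neg x) \<bullet> p = 0" using *[of "P 9"] sym[of 9 "neg x" p] by (simp add: P_in_sp inner_commute)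
qed

lemma normal_form:
  assumes x: "norm x = 1" and r: "0 < r" "r < 1" "q x = r\<^sup>2"
    and p: "p \<in> E 1 1" "norm p = 1" and s: "s \<in> E 1 1" "norm s = 1" "s \<bullet> p = 0"
  obtains A where "symm A" "A x = sqrt ((1 + r) / 2) *\<^sub>R p + sqrt ((1 - r) / 2) *\<^sub>R P 9 s"
proof -
  define l where "l = sqrt ((1 + r) / 2)"
  define \<mu> where "\<mu> = sqrt ((1 - r) / 2)"
  have l: "l > 0" "l\<^sup>2 = (1 + r) / 2" and \<mu>: "\<mu> \<ge> 0" "\<mu>\<^sup>2 = (1 - r) / 2"
    using r by (auto simp: l_def \<mu>_def)
  have Psp: "P i \<in> sp {1..9}" if "i \<in> {1..9}" for i using that by (rule P_in_sp) auto
  have nP: "norm (P i p) = 1" if "i \<le> 9" for i using that p by (simp add: norm_P)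
  note symmI = symm_sp'[OF _ le9 p(2)]
  obtain A1 where A1: "symm A1" "P 0 (A1 x) \<bullet> A1 x = r" "\<And>i. 0 < i \<Longrightarrow> i \<le> 9 \<Longrightarrow> P i (A1 x) \<bullet> A1 x = 0"
    using rotate_to_axis[OF _ r(1,3)] by auto
  define x1 where "x1 = A1 x"
  have "norm x1 = 1" using A1(1) x by (simp add: x1_def symm_def orthogonal_transformation_norm)
  moreover have "S x1 \<bullet> x1 = 0" if Ssp: "S \<in> sp {1..9}" for S
  proof -
    obtain a where S: "S = (\<lambda>x. \<Sum>i\<in>{1..9}. a i *\<^sub>R P i x)" using sp_E[OF Ssp] .
    show ?thesis unfolding S inner_sum_left by (intro sum.neutral) (simp add: x1_def A1(3))
  qed
  ultimately have x1: "aligned r x1" using A1(2) by (simp add: aligned_def x1_def)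

  obtain T e where T: "T \<in> sp {1..9}" "norm e = 1" "norm (T e) = 1" "T (P 9 (pos x1)) \<in> E 1 1"
    by (rule pos_into_E)
  define x2 where "x2 = T (P 9 x1)"
  have x2: "aligned r x2"
    using aligned_step[OF aligned_step[OF x1 Psp p(2) nP] T(1-3), of 9] by (simp add: x2_def)
  have pos2: "pos x2 \<in> E 1 1" using T(4) pos_even[OF T(1) Psp, of 9] by (simp add: x2_def)
  have n2: "norm (pos x2) = l" using norm_pos[OF x2] by (simp add: l_def real_sqrt_unique)

  have "P 1 (l *\<^sub>R p) \<in> E (-1) (-1)"
    using W_E[OF P_in_sp[of 1 "{1..8}"], of "l *\<^sub>R p" 1 1] p(1) subspace_E by (simp add: subspace_scale)
  moreover have "pos x2 \<noteq> 0" using n2 l by auto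
  ultimately obtain C where C: "C \<in> W" "C (pos x2) = P 1 (l *\<^sub>R p)" using W_transitive[OF pos2] by blast
  have Csp: "C \<in> sp {1..9}" using C W_sub by blast
  define e' where "e' = pos x2 /\<^sub>R l"
  have e': "norm e' = 1" "norm (C e') = 1"
    using n2 l C(2) p(2) by (simp_all add: e'_def sp_simps[OF Csp le9] norm_P)
  define x3 where "x3 = P 1 (C x2)"
  have x3: "aligned r x3"
    using aligned_step[OF aligned_step[OF x2 Csp e'] Psp p(2) nP, of 1] by (simp add: x3_def)
  have pos3: "pos x3 = l *\<^sub>R p" using pos_even[OF Psp Csp, of 1] C(2) by (simp add: x3_def P_P)

  note s3 = aligned_neg[OF x3 p pos3 l(1)]
  have "norm (neg x3) = \<mu>" using norm_neg[OF x3] by (simp add: \<mu>_def real_sqrt_unique)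
  hence n3: "norm (P 9 (neg x3)) = norm (\<mu> *\<^sub>R s)" using s(2) \<mu>(1) by (simp add: norm_P)
  have s': "\<mu> *\<^sub>R s \<in> E 1 1" "(\<mu> *\<^sub>R s) \<bullet> p = 0" using s subspace_E by (simp_all add: subspace_scale)
  obtain D U B where D: "D \<in> W" "U \<in> W" "B \<in> W" "norm (D p) = 1" "norm (U p) = 1" "norm (B p) = 1"
    "P 8 (D (U (B p))) = - p" "P 8 (D (U (B (P 9 (neg x3))))) = - (\<mu> *\<^sub>R s)"
    using stabilizer_transitive[OF p s3 s' n3] by blast
  note lin = sp_simps[OF D(1) le8] sp_simps[OF D(2) le8] sp_simps[OF D(3) le8] P_simps[of 8, simplified]
    P_simps[of 9, simplified]
  \<comment> \<open>Each of the four factors anticommutes with \<open>P 9\<close>, so their product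
    commutes with it. The product negates both target vectors, which a final \<open>uminus\<close>
    corrects.\<close>
  have "P 9 (P 8 (D (U (B (P 9 (neg x3)))))) = P 8 (D (U (B (P 9 (P 9 (neg x3))))))"
    using D(1-3) by (simp add: P_swap W_P9 lin)
  hence "P 8 (D (U (B (neg x3)))) = - (\<mu> *\<^sub>R P 9 s)" using D(8) by (simp add: P_P lin)
  hence "P 8 (D (U (B (l *\<^sub>R p + neg x3)))) = - (l *\<^sub>R p + \<mu> *\<^sub>R P 9 s)" using D(7) by (simp add: lin)
  hence 4: "- P 8 (D (U (B x3))) = l *\<^sub>R p + \<mu> *\<^sub>R P 9 s" using pos_neg[of x3] pos3 by simp
  have "symm (\<lambda>x. - P 8 (D (U (B (P 1 (C (T (P 9 (A1 x)))))))))"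
  proof (intro symm_comp[OF symm_uminus] symm_comp[OF symm_sp'[OF P8_W le8 p(2) nP]]
      symm_comp[OF symm_sp'[OF D(1) le8 p(2) D(4)]] symm_comp[OF symm_sp'[OF D(2) le8 p(2) D(5)]]
      symm_comp[OF symm_sp'[OF D(3) le8 p(2) D(6)]] symm_comp[OF symmI[OF Psp nP]]
      symm_comp[OF symm_sp'[OF Csp le9 e']] symm_comp[OF symm_sp'[OF T(1) le9 T(2,3)]] A1(1))
  qed auto
  moreover have "- P 8 (D (U (B (P 1 (C (T (P 9 (A1 x)))))))) = l *\<^sub>R p + \<mu> *\<^sub>R P 9 s"
    using 4 by (simp add: x3_def x2_def x1_def)
  ultimately show thesis using that unfolding l_def \<mu>_def by blast
qed

text \<open>Both points are moved to the same normal form. The level \<open>c\<close> of the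
  function is the level \<open>(1 - c) / 2\<close> of \<open>q\<close>, strictly between 0 and
  1.\<close>

lemma homogeneous:
  assumes "- 1 < c" "c < 1"
  shows "homogeneously_embedded (clifford_hypersurface 9 P c)"
  unfolding homogeneously_embedded_def
proof (intro ballI)
  fix x y assume xy: "x \<in> clifford_hypersurface 9 P c" "y \<in> clifford_hypersurface 9 P c"
  define r where "r = sqrt ((1 - c) / 2)"
  have r: "0 < r" "r < 1" "r\<^sup>2 = (1 - c) / 2" using assms by (auto simp: r_def)
  have n: "norm x = 1" "norm y = 1" "q x = r\<^sup>2" "q y = r\<^sup>2"
    using xy r by (auto simp: clifford_hypersurface_def clifford_function_eq)
  obtain p where p: "p \<in> E 1 1" "norm p = 1"
    using exists_unit_orthogonal[OF subspace_E, of "{}" 1 1] by (auto simp: dim_E)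
  obtain s where s: "s \<in> E 1 1" "norm s = 1" "s \<bullet> p = 0"
    using exists_unit_orthogonal[OF subspace_E, of "{p}" 1 1] p by (auto simp: dim_E)
  obtain A where A: "symm A" "A x = sqrt ((1 + r) / 2) *\<^sub>R p + sqrt ((1 - r) / 2) *\<^sub>R P 9 s"
    using normal_form[OF n(1) r(1,2) n(3) p s] .
  obtain B where B: "symm B" "B y = sqrt ((1 + r) / 2) *\<^sub>R p + sqrt ((1 - r) / 2) *\<^sub>R P 9 s"
    using normal_form[OF n(2) r(1,2) n(4) p s] .
  have "inj B" using B(1) orthogonal_transformation_inj by (auto simp: symm_def)
  hence "inv B (A x) = y" using A(2) B(2) by (metis inv_f_f)
  moreover have "(\<lambda>x. inv B (A x)) \<in> orthogonal_stabilizer (clifford_hypersurface 9 P c)"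
    by (rule symm_stabilizer[OF symm_comp[OF symm_inv[OF B(1)] A(1)]])
  ultimately show "\<exists>A\<in>orthogonal_stabilizer (clifford_hypersurface 9 P c). A x = y" by metis
qed

end

section \<open>Comparison of focal manifolds\<close>

text \<open>Polarization at the pair \<open>x\<close>, \<open>L x\<close>.\<close>

lemma symmetric_eq_0:
  fixes L :: "'a::real_inner \<Rightarrow> 'a"
  assumes L: "linear L" "\<And>x y. L x \<bullet> y = x \<bullet> L y" and 0: "\<And>x. L x \<bullet> x = 0"
  shows "L x = 0"
proof -
  have "L (x + L x) \<bullet> (x + L x) = 2 * (L x \<bullet> L x)"
    using 0[of x] 0[of "L x"] L(2)[of "L x" x]
    by (simp add: linear_add[OF L(1)] inner_add_left inner_add_right)
  thus ?thesis using 0[of "x + L x"] by simp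
qed

context clifford
begin

section \<open>Focal points and tangent directions of a single system\<close>

lemma q_eq_1:
  assumes "J \<subseteq> {0..m}" "(\<Sum>i\<in>J. (P i x \<bullet> x)\<^sup>2) = 1" "norm x = 1"
  shows "q x = 1"
proof -
  have "1 \<le> q x" unfolding q_def assms(2)[symmetric] by (rule sum_mono2) (use assms(1) in auto)
  thus ?thesis using q_le[OF assms(3)] by simp
qed

lemma q_circle:
  "q (cos t *\<^sub>R x + sin t *\<^sub>R v)
    = (\<Sum>i=0..m. ((cos t)\<^sup>2 * (P i x \<bullet> x) + (sin t)\<^sup>2 * (P i v \<bullet> v) + 2 * sin t * cos t * (P i x \<bullet> v))\<^sup>2)"
  unfolding q_def
proof (intro sum.cong refl)
  fix i assume "i \<in> {0..m}"
  hence i: "i \<le> m" by simp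
  have "P i v \<bullet> x = P i x \<bullet> v" using sym[OF i, of x v] by (simp add: inner_commute)
  hence "P i (cos t *\<^sub>R x + sin t *\<^sub>R v) \<bullet> (cos t *\<^sub>R x + sin t *\<^sub>R v)
    = (cos t)\<^sup>2 * (P i x \<bullet> x) + (sin t)\<^sup>2 * (P i v \<bullet> v) + 2 * sin t * cos t * (P i x \<bullet> v)"
    by (simp add: P_simps[OF i] inner_add_left inner_add_right power2_eq_square algebra_simps)
  thus "(P i (cos t *\<^sub>R x + sin t *\<^sub>R v) \<bullet> (cos t *\<^sub>R x + sin t *\<^sub>R v))\<^sup>2
    = ((cos t)\<^sup>2 * (P i x \<bullet> x) + (sin t)\<^sup>2 * (P i v \<bullet> v) + 2 * sin t * cos t * (P i x \<bullet> v))\<^sup>2" by simp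
qed

text \<open>This is the equality case of Cauchy-Schwarz in \<open>q_le\<close>: the unit element
  given by the moment vector of \<open>x\<close> fixes \<open>x\<close>.\<close>

lemma focal_fixed:
  assumes x: "norm x = 1" "q x = 1"
  obtains T where "T \<in> sp {0..m}" "T x = x" "\<And>y v. T y \<bullet> v = (\<Sum>i=0..m. (P i x \<bullet> x) * (P i y \<bullet> v))"
proof -
  define T where "T = (\<lambda>y. \<Sum>i\<in>{0..m}. (P i x \<bullet> x) *\<^sub>R P i y)"
  have T: "T \<in> sp {0..m}" unfolding T_def by (rule sp_I)
  have Ti: "T y \<bullet> v = (\<Sum>i=0..m. (P i x \<bullet> x) * (P i y \<bullet> v))" for y v by (simp add: T_def inner_sum_left)
  have "T x \<bullet> x = 1" using x(2) by (simp add: Ti q_def power2_eq_square)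
  moreover have "T x \<bullet> T x = (\<Sum>i\<in>{0..m}. (P i x \<bullet> x) * (P i x \<bullet> x)) * (x \<bullet> x)"
    unfolding T_def by (rule inner_sp_sp) auto
  hence "T x \<bullet> T x = 1" using x by (simp add: q_def norm_eq_1 power2_eq_square)
  ultimately have "(T x - x) \<bullet> (T x - x) = 0" using x(1)
    by (simp add: inner_diff_left inner_diff_right inner_commute norm_eq_1)
  thus thesis using that[OF T _ Ti] by simp
qed

text \<open>The tangent space of the focal manifold \<open>q = 1\<close> at \<open>x\<close>: comparing the values of \<open>q\<close>
  at \<open>t = 0\<close>, \<open>\<plusminus>\<pi>/4\<close>, \<open>\<pi>/2\<close> amounts to taking the second derivative along the circle.\<close>

lemma focal_tangent:
  assumes x: "norm x = 1" and v: "norm v = 1" "x \<bullet> v = 0"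
    and circ: "\<And>t. q (cos t *\<^sub>R x + sin t *\<^sub>R v) = 1"
    and T: "T \<in> sp {0..m}" "T x = x" "\<And>y v. T y \<bullet> v = (\<Sum>i=0..m. (P i x \<bullet> x) * (P i y \<bullet> v))"
  obtains S where "S \<in> sp {0..m}" "T (v - S x) = v - S x"
proof -
  have I: "{0..m} \<subseteq> {..m}" by auto
  define b c d where "b = (\<lambda>i. P i x \<bullet> x)" and "c = (\<lambda>i. P i v \<bullet> v)" and "d = (\<lambda>i. P i x \<bullet> v)"
  define D where "D = (\<Sum>i=0..m. (d i)\<^sup>2)"
  define S where "S = (\<lambda>y. \<Sum>i\<in>{0..m}. d i *\<^sub>R P i y)"
  have S: "S \<in> sp {0..m}" unfolding S_def by (rule sp_I)
  have b: "(\<Sum>i=0..m. (b i)\<^sup>2) = 1" and c: "(\<Sum>i=0..m. (c i)\<^sup>2) = 1"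
    using circ[of 0] circ[of "pi/2"] unfolding q_circle by (simp_all add: b_def c_def)
  have cs: "(cos (pi/4))\<^sup>2 = (1/2::real)" "(sin (pi/4))\<^sup>2 = (1/2::real)" "2 * sin (pi/4) * cos (pi/4) = (1::real)"
    by (simp_all add: cos_45 sin_45 power_divide)
  have p: "(\<Sum>i=0..m. (b i / 2 + c i / 2 + d i)\<^sup>2) = 1"
    using circ[of "pi/4"] unfolding q_circle cs by (simp add: b_def c_def d_def)
  have "2 * sin (- (pi/4)) * cos (- (pi/4)) = (-1::real)" using cs(3) by simp
  hence n: "(\<Sum>i=0..m. (b i / 2 + c i / 2 - d i)\<^sup>2) = 1"
    using circ[of "-(pi/4)"] cs unfolding q_circle by (simp add: b_def c_def d_def)
  have "(\<Sum>i=0..m. (b i / 2 + c i / 2 + d i)\<^sup>2) + (\<Sum>i=0..m. (b i / 2 + c i / 2 - d i)\<^sup>2)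
      = (\<Sum>i=0..m. (b i)\<^sup>2 / 2 + (c i)\<^sup>2 / 2 + b i * c i + 2 * (d i)\<^sup>2)"
    unfolding sum.distrib[symmetric] by (intro sum.cong refl) (simp add: power2_eq_square algebra_simps)
  also have "\<dots> = 1 + (\<Sum>i=0..m. b i * c i) + 2 * D"
    using b c by (simp add: sum.distrib D_def sum_divide_distrib[symmetric] sum_distrib_left[symmetric])
  finally have bc: "T v \<bullet> v = 1 - 2 * D" using p n by (simp add: T(3) b_def c_def)
  note Ts = sym_sp[OF T(1) I]
  have "norm (T x) = 1" using T(2) x by simp
  note TT = sp_involution[OF T(1) I x this]
  have bd: "(\<Sum>i=0..m. b i * d i) = 0"
    using T(3)[of x v] v(2) unfolding T(2) by (simp add: b_def d_def)
  have Sx: "S x \<bullet> v = D" by (simp add: S_def inner_sum_left D_def power2_eq_square d_def)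
  have SS: "S x \<bullet> S x = D"
    using inner_sp_sp[OF I, of d x d] x by (simp add: S_def D_def norm_eq_1 power2_eq_square)
  have "T x \<bullet> S x = 0" 
    using bd by (simp add: T(2) S_def inner_sum_right b_def inner_commute[of x] mult.commute)
  hence "T (S x) = - S (T x)" by (rule sp_anticommute[OF T(1) S I x])
  hence TS: "T (S x) = - S x" using T(2) by simp
  hence TvS: "T v \<bullet> S x = - D" using Ts[of v "S x"] Sx by (simp add: inner_commute)
  have TvTv: "T v \<bullet> T v = 1" using Ts[of v "T v"] TT v(1) by (simp add: norm_eq_1)
  \<comment> \<open>The products computed so far determine \<open>w \<bullet> w\<close>, and all
    terms cancel.\<close>
  define w where "w = v - T v - 2 *\<^sub>R S x"
  have "w \<bullet> w = 0" using v(1) bc Sx SS TvS TvTv unfolding w_def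
    by (simp add: inner_diff_left inner_diff_right inner_commute norm_eq_1)
  hence "w = 0" by (rule inner_eq_zero_iff[THEN iffD1])
  hence "T v = v - 2 *\<^sub>R S x" by (simp add: w_def algebra_simps)
  hence "T (v - S x) = v - S x"
    by (simp add: sp_simps[OF T(1) I] TS scaleR_2)
  thus thesis using that S by blast
qed

end

text \<open>The assumption is what a congruence implies for focal points: the levels 0 and 1 of
  \<open>Q.q\<close> are the two focal sets of the second family, and a congruence need not respect
  their order.\<close>

locale clifford_pair = P: clifford10 P + Q: clifford 6 Q
  for P Q :: "nat \<Rightarrow> 'a::euclidean_space \<Rightarrow> 'a" +
  assumes focal: "norm x = 1 \<Longrightarrow> P.q x = 1 \<Longrightarrow> Q.q x = 0 \<or> Q.q x = 1"
begin

text \<open>Along the circle \<open>Q.q\<close> is continuous with values in \<open>{0, 1}\<close>,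
  hence constant.\<close>

lemma q_1_circle:
  assumes x: "norm x = 1" "Q.q x = 1" and v: "norm v = 1" "x \<bullet> v = 0"
    and P: "\<And>t. P.q (cos t *\<^sub>R x + sin t *\<^sub>R v) = 1"
  shows "Q.q (cos t *\<^sub>R x + sin t *\<^sub>R v) = 1"
proof -
  define g where "g = (\<lambda>t. Q.q (cos t *\<^sub>R x + sin t *\<^sub>R v))"
  have norm: "norm (cos t *\<^sub>R x + sin t *\<^sub>R v) = 1" for t
    using x v by (simp add: norm_eq_1 inner_add_left inner_add_right inner_commute power2_eq_square[symmetric])
  have "g ` UNIV \<subseteq> {0, 1}" using focal[OF norm P] by (auto simp: g_def)
  hence "finite (g ` UNIV)" by (rule finite_subset) simp
  moreover have "continuous_on UNIV g" unfolding g_def Q.q_circle by (intro continuous_intros)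
  ultimately have "g constant_on UNIV"
    by (intro continuous_finite_range_constant) auto
  hence "g t = g 0" by (auto simp: constant_on_def)
  thus ?thesis using x by (simp add: g_def)
qed

text \<open>If \<open>Q.q x = 1\<close>, circles through \<open>x\<close> on which
  \<open>P.q = 1\<close> also satisfy \<open>Q.q = 1\<close>, so their directions lie in
  \<open>U\<close>, of dimension at most 16 + 7. Together with \<open>x\<close>, however, they span
  at least \<open>Ei\<close> and \<open>M\<close>, of dimension 16 + 9.\<close>

lemma q_0_on_eigenspace:
  assumes i: "i \<le> 9" and e: "e = 1 \<or> e = -1" and x: "norm x = 1" "P i x = e *\<^sub>R x"
  shows "Q.q x = 0"
proof (rule ccontr)
  have ee: "e * e = 1" using e by auto
  have q1: "P.q y = 1" if "norm y = 1" "P i y = e *\<^sub>R y" for y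
    by (rule P.q_eq_1[of "{i}"]) (use that i ee in \<open>auto simp: norm_eq_1 power_mult_distrib power2_eq_square\<close>)
  assume "Q.q x \<noteq> 0"
  hence Qx: "Q.q x = 1" using focal[OF x(1) q1[OF x]] by simp
  obtain T where T: "T \<in> Q.sp {0..6}" "T x = x" "\<And>y v. T y \<bullet> v = (\<Sum>i=0..6. (Q i x \<bullet> x) * (Q i y \<bullet> v))"
    using Q.focal_fixed[OF x(1) Qx] by blast
  have I6: "{0..6} \<subseteq> {..6::nat}" by auto
  have x0: "x \<noteq> 0" using x by auto
  define F where "F = {y. T y = y}"
  define N where "N = {S x |S. S \<in> Q.sp {0..6}}"
  define U where "U = {y + z |y z. y \<in> F \<and> z \<in> N}"
  have F: "subspace F" by (simp add: F_def subspace_def Q.sp_simps[OF T(1) I6])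
  have N: "subspace N" "dim N = 7" using Q.sp_image[OF I6 x0] by (simp_all add: N_def)
  \<comment> \<open>This prepares a unit element \<open>R\<close> orthogonal to \<open>T\<close>,
    the partner that exchanges the eigenspaces of \<open>T\<close>.\<close>
  have "x \<in> N" unfolding N_def by (intro CollectI exI[of _ T]) (simp add: T(1,2))
  then obtain z where "z \<in> N" and z: "norm z = 1" "z \<bullet> x = 0"
    using exists_unit_orthogonal[OF N(1), of "{x}"] N(2) by auto
  then obtain R where R: "R \<in> Q.sp {0..6}" "z = R x" by (auto simp: N_def)
  have "norm (T x) = 1" using T x by simp
  note TT = Q.sp_involution[OF T(1) I6 x(1) this]
  have "norm (R x) = 1" using R z by simp
  note RR = Q.sp_involution[OF R(1) I6 x(1) this]
  have "R x \<bullet> T x = 0" using R z T by simp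
  note RT = Q.sp_anticommute[OF R(1) T(1) I6 x(1) this]
  have "2 * dim {x \<in> UNIV. T x = 1 *\<^sub>R x} = dim (UNIV :: 'a set)"
    by (rule dim_eigenspace_involution[where S = R])
       (use TT RR RT in \<open>auto simp: Q.linear_sp[OF T(1) I6] Q.linear_sp[OF R(1) I6] intro!: inj_on_inverseI[of _ R]\<close>)
  hence dF: "dim F = 16" using P.dim32 by (simp add: F_def)
  have dU: "dim U \<le> 23" using dim_sums_Int[OF F N(1)] dF N(2) by (simp add: U_def)
  have U: "subspace U" unfolding U_def by (rule subspace_sums[OF F N(1)])
  have xU: "x \<in> U" using T subspace_0[OF N(1)] unfolding U_def F_def by force
  have tangent: "v \<in> U" if v: "norm v = 1" "x \<bullet> v = 0" and c: "\<And>t. P.q (cos t *\<^sub>R x + sin t *\<^sub>R v) = 1" for v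
  proof -
    obtain S where S: "S \<in> Q.sp {0..6}" "T (v - S x) = v - S x"
      using Q.focal_tangent[OF x(1) v q_1_circle[OF x(1) Qx v c] T] by blast
    hence "v - S x \<in> F" "S x \<in> N" by (auto simp: F_def N_def)
    moreover have "v = (v - S x) + S x" by simp
    ultimately show ?thesis unfolding U_def by blast
  qed
  define Ei where "Ei = {y. P i y = e *\<^sub>R y}"
  \<comment> \<open>\<open>P i x\<close> is a multiple of \<open>x\<close> and lies in
    \<open>Ei\<close>; the products with the other members lie in the opposite eigenspace, so
    \<open>M\<close> meets \<open>Ei\<close> only in 0.\<close>
  define M where "M = {S x |S. S \<in> P.sp ({0..9} - {i})}"
  have I9: "{0..9} - {i} \<subseteq> {..9}" by auto
  have Ei: "subspace Ei" using i by (simp add: Ei_def subspace_def P.P_simps algebra_simps)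
  have M: "subspace M" "dim M = 9" "M = span ((\<lambda>i. P i x) ` ({0..9} - {i}))"
    using P.sp_image[OF I9 x0] i by (simp_all add: M_def)
  define k where "k = (if i = 0 then 1 else 0 :: nat)"
  have k: "k \<le> 9" "k \<noteq> i" by (auto simp: k_def)
  have "2 * dim {x \<in> UNIV. P i x = e *\<^sub>R x} = dim (UNIV :: 'a set)"
    by (rule dim_eigenspace_involution[where S = "P k"])
       (use e i k P.anti[of i k] in \<open>auto simp: P.linear_P P.P_P intro!: inj_on_inverseI[of _ "P k"]\<close>)
  hence dE: "dim Ei = 16" using P.dim32 by (simp add: Ei_def)
  have "P i y = - e *\<^sub>R y" if y: "y \<in> M" for y
  proof -
    obtain S where S: "S \<in> P.sp ({0..9} - {i})" "y = S x" using y by (auto simp: M_def)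
    have "P i (S x) = - S (P i x)" by (rule P.P_sp_anticommute[OF S(1) I9]) (use i in auto)
    thus ?thesis using x(2) S by (simp add: P.sp_simps[OF S(1) I9])
  qed
  hence "y = 0" if "y \<in> Ei \<inter> M" for y
    using that e by (auto simp: Ei_def) (metis eq_neg_iff_add_eq_0 scaleR_2 scaleR_eq_0_iff zero_neq_numeral)+
  hence "Ei \<inter> M = {0}" using subspace_0[OF Ei] subspace_0[OF M(1)] by blast
  hence d25: "dim {y + z |y z. y \<in> Ei \<and> z \<in> M} = 25" using dim_sums_Int[OF Ei M(1)] dE M(2) by simp
  have "Ei \<subseteq> U"
  proof
    fix y assume y: "y \<in> Ei"
    define y' where "y' = y - (y \<bullet> x) *\<^sub>R x"
    have y': "y' \<in> Ei" using y x(2) Ei by (simp add: y'_def Ei_def P.P_simps i algebra_simps)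
    have "x \<bullet> x = 1" using x by (simp add: norm_eq_1)
    hence o: "x \<bullet> y' = 0" by (simp add: y'_def inner_diff_right inner_commute)
    have "y' \<in> U"
    proof (cases "y' = 0")
      case False
      define v where "v = y' /\<^sub>R norm y'"
      have v: "norm v = 1" "x \<bullet> v = 0" "P i v = e *\<^sub>R v"
        using False o y' i by (simp_all add: v_def Ei_def P.P_simps)
      have "v \<in> U"
      proof (rule tangent[OF v(1,2)])
        fix t
        show "P.q (cos t *\<^sub>R x + sin t *\<^sub>R v) = 1"
        proof (rule q1)
          show "norm (cos t *\<^sub>R x + sin t *\<^sub>R v) = 1"
            using x v by (simp add: norm_eq_1 inner_add_left inner_add_right inner_commute power2_eq_square[symmetric])
          show "P i (cos t *\<^sub>R x + sin t *\<^sub>R v) = e *\<^sub>R (cos t *\<^sub>R x + sin t *\<^sub>R v)"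
            using x v i by (simp add: P.P_simps algebra_simps)
        qed
      qed
      hence "norm y' *\<^sub>R v \<in> U" by (rule subspace_scale[OF U])
      thus ?thesis using False by (simp add: v_def)
    qed (simp add: subspace_0[OF U])
    hence "y' + (y \<bullet> x) *\<^sub>R x \<in> U" by (intro subspace_add subspace_scale U xU)
    thus "y \<in> U" by (simp add: y'_def)
  qed
  \<comment> \<open>On the circle towards \<open>P j x\<close> the moments for \<open>i\<close> and
    \<open>j\<close> are \<open>e * cos (2 * t)\<close> and \<open>sin (2 * t)\<close>; their
    squares already add up to 1.\<close>
  moreover have "P j x \<in> U" if j: "j \<le> 9" "j \<noteq> i" for j
  proof (rule tangent)
    have ij: "P i x \<bullet> P j x = 0" using i j by (simp add: P.inner_P_anti)
    have xj: "P j x \<bullet> x = 0" using ij e by (auto simp: x(2) inner_commute)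
    have xx: "x \<bullet> x = 1" using x by (simp add: norm_eq_1)
    show "norm (P j x) = 1" using j x by (simp add: P.norm_P)
    show "x \<bullet> P j x = 0" using xj by (simp add: inner_commute)
    fix t
    define y where "y = cos t *\<^sub>R x + sin t *\<^sub>R P j x"
    have PP: "P i (P j x) = - e *\<^sub>R P j x" using P.anti[of j i x] i j x(2) by (simp add: P.P_simps)
    have "P i y \<bullet> y = e * cos (2 * t)"
      using i xj xx j unfolding y_def cos_double
      by (simp add: P.P_simps x(2) PP inner_add_left inner_add_right inner_diff_left inner_commute P.inner_P_P
          power2_eq_square algebra_simps)
    moreover have "P j y \<bullet> y = sin (2 * t)"
      using j xj xx unfolding y_def
      by (simp add: P.P_simps P.P_P inner_add_left inner_add_right inner_commute P.inner_P_P sin_double)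
    ultimately have "(\<Sum>k\<in>{i, j}. (P k y \<bullet> y)\<^sup>2) = 1"
      using j(2) ee by (simp add: power_mult_distrib power2_eq_square[of e])
    moreover have "norm y = 1" unfolding y_def
      using xj xx j by (simp add: norm_eq_1 inner_add_left inner_add_right inner_commute P.inner_P_P power2_eq_square[symmetric])
    ultimately show "P.q (cos t *\<^sub>R x + sin t *\<^sub>R P j x) = 1"
      unfolding y_def[symmetric] by (intro P.q_eq_1[of "{i, j}"]) (use i j in auto)
  qed
  hence "M \<subseteq> U" unfolding M(3) by (intro span_minimal U image_subsetI) simp
  ultimately have "{y + z |y z. y \<in> Ei \<and> z \<in> M} \<subseteq> U" using subspace_add[OF U] by blast
  hence "25 \<le> dim U" unfolding d25[symmetric] by (rule dim_subset)
  thus False using dU by simp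
qed

text \<open>The form of \<open>Q j\<close> vanishes on both eigenspaces of \<open>P i\<close>.
  Comparing its values at \<open>w + P i w\<close> and \<open>w - P i w\<close> gives the form of
  the anticommutator, a symmetric map, which is therefore 0.\<close>

lemma Q_P_anticommute:
  assumes i: "i \<le> 9" and j: "j \<le> 6"
  shows "Q j (P i x) = - P i (Q j x)"
proof -
  have zero: "Q j y \<bullet> y = 0" if e: "e = 1 \<or> e = -1" and y: "P i y = e *\<^sub>R y" for e y
  proof (cases "y = 0")
    case False
    define v where "v = y /\<^sub>R norm y"
    have "norm v = 1" "P i v = e *\<^sub>R v" using False y i by (simp_all add: v_def P.P_simps)
    hence "Q.q v = 0" using q_0_on_eigenspace[OF i e] by blast
    hence "\<forall>k\<in>{0..6}. (Q k v \<bullet> v)\<^sup>2 = 0" unfolding Q.q_def by (subst (asm) sum_nonneg_eq_0_iff) auto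
    hence "Q j v \<bullet> v = 0" using j by auto
    moreover have "y = norm y *\<^sub>R v" using False by (simp add: v_def)
    hence "Q j y \<bullet> y = (norm y)\<^sup>2 * (Q j v \<bullet> v)" using j
      by (metis Q.P_simps(4) inner_scaleR_left inner_scaleR_right mult.assoc power2_eq_square)
    ultimately show ?thesis by simp
  qed (simp add: Q.P_simps j)
  define L where "L = (\<lambda>x. Q j (P i x) + P i (Q j x))"
  have "L x = 0"
  proof (rule symmetric_eq_0[of L])
    show "linear L" using i j by (intro linearI) (simp_all add: L_def P.P_simps Q.P_simps algebra_simps)
    show "L x \<bullet> y = x \<bullet> L y" for x y
      using i j by (simp add: L_def inner_add_left inner_add_right P.sym Q.sym)
    show "L w \<bullet> w = 0" for w
    proof -
      define a b where "a = w + P i w" and "b = w - P i w"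
      have "Q j a \<bullet> a = 0" "Q j b \<bullet> b = 0"
        using zero[of 1 a] zero[of "-1" b] i by (simp_all add: a_def b_def P.P_simps P.P_P)
      moreover have "Q j a \<bullet> a - Q j b \<bullet> b = 2 * (L w \<bullet> w)"
        using i j P.sym[OF i, of "Q j w" w] unfolding a_def b_def L_def
        by (simp add: Q.P_simps inner_add_left inner_add_right inner_diff_left inner_diff_right)
      ultimately show ?thesis by simp
    qed
  qed
  thus ?thesis unfolding L_def by (rule eq_neg_iff_add_eq_0[THEN iffD2])
qed

text \<open>\<open>K p\<close> is a unit vector of \<open>E 1 1\<close> orthogonal to
  \<open>p\<close>. Up to a common sign, some product of elements of \<open>W\<close> fixes
  \<open>p\<close> and negates \<open>K p\<close>; as it commutes with \<open>K\<close>, it must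
  also fix \<open>K p\<close>.\<close>

lemma no_clifford_pair: False
proof -
  define K where "K = (\<lambda>x. Q 0 (Q 1 x))"
  have Klin: "linear K" by (rule linearI) (simp_all add: K_def Q.P_simps)
  have KP: "K (P i x) = P i (K x)" if "i \<le> 9" for i x
    using that by (simp add: K_def Q_P_anticommute Q.P_simps)
  have KT: "K (T x) = T (K x)" if T: "T \<in> P.W" for T x
  proof -
    obtain a where "T = (\<lambda>x. \<Sum>i\<in>{1..8}. a i *\<^sub>R P i x)" using P.sp_E[OF T] .
    thus ?thesis by (simp add: linear_sum[OF Klin] linear_scale[OF Klin] KP)
  qed
  obtain p where p: "p \<in> P.E 1 1" "norm p = 1"
    using exists_unit_orthogonal[OF P.subspace_E, of "{}" 1 1] by (auto simp: P.dim_E)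
  have "K (P.eta p) = P.eta (K p)" by (simp add: P.eta_def KP)
  hence s: "K p \<in> P.E 1 1" "K p \<bullet> p = 0"
    using p(1) KP[of 0 p] Q.inner_P_anti[of 1 0 p] by (auto simp: P.E_def K_def Q.sym)
  have "- K p \<in> P.E 1 1" "(- K p) \<bullet> p = 0" "norm (K p) = norm (- K p)"
    using s by (simp_all add: subspace_neg[OF P.subspace_E])
  then obtain C U B where CUB: "C \<in> P.W" "U \<in> P.W" "B \<in> P.W"
    "P 8 (C (U (B p))) = - p" "P 8 (C (U (B (K p)))) = - (- K p)"
    using P.stabilizer_transitive[OF p s] by metis
  have "K p = P 8 (C (U (B (K p))))" using CUB(5) by simp
  also have "\<dots> = K (P 8 (C (U (B p))))" using CUB(1-3) by (simp add: KP KT)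
  also have "\<dots> = - K p" unfolding CUB(4) by (rule linear_neg[OF Klin])
  finally have "K p = - K p" .
  hence "K p = 0" by (metis eq_neg_iff_add_eq_0 scaleR_2 scaleR_eq_0_iff zero_neq_numeral)
  moreover have "norm (K p) = 1" using p by (simp add: K_def Q.norm_P)
  ultimately show False by simp
qed

end

theorem theorem6p3:
  fixes F :: "(real ^ 32) set set"
  assumes "clifford_isoparametric_family 9 6 F"
  shows "homogeneous_family F \<and>
         (\<forall>G :: (real ^ 32) set set.
            clifford_isoparametric_family 6 9 G \<longrightarrow> \<not> congruent_families F G)"
proof -
  obtain P where "clifford_system 9 P" and F: "F = clifford_hypersurface 9 P ` {-1<..<1}"
    using assms by (auto simp: clifford_isoparametric_family_def)
  then interpret P: clifford10 P by unfold_locales simp_all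
  have "homogeneous_family F" using P.homogeneous by (auto simp: homogeneous_family_def F)
  moreover have "\<not> congruent_families F G" if G': "clifford_isoparametric_family 6 9 G" for G :: "(real ^ 32) set set"
  proof
    assume "congruent_families F G"
    then obtain A where A: "orthogonal_transformation A" and AG: "(\<lambda>M. A ` M) ` F = G"
      by (auto simp: congruent_families_def)
    obtain Q where "clifford_system 6 Q" and G: "G = clifford_hypersurface 6 Q ` {-1<..<1}"
      using G' by (auto simp: clifford_isoparametric_family_def)
    then interpret Q: clifford 6 Q by unfold_locales
    have Ainv: "A (inv A x) = x" "inv A (A x) = x" for x
      using orthogonal_transformation_surj[OF A] orthogonal_transformation_inj[OF A]
      by (simp_all add: surj_f_inv_f inv_f_f)
    have Ai: "linear (inv A)" "linear A"
      using orthogonal_transformation_inv[OF A] A by (auto simp: orthogonal_transformation_linear)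
    have Adot: "A x \<bullet> A y = x \<bullet> y" for x y using A by (simp add: orthogonal_transformation_def)
    \<comment> \<open>The second system is pulled back along \<open>A\<close>, so that both quartic
      forms are compared at the same point \<open>x\<close>.\<close>
    define R where "R = (\<lambda>i x. inv A (Q i (A x)))"
    have Rdot: "R i x \<bullet> y = Q i (A x) \<bullet> A y" for i x y
      using Adot[of "R i x" y] by (simp add: R_def Ainv)
    have "clifford_system 6 R"
      unfolding clifford_system_def symmetric_endomorphism_def
    proof (intro conjI allI impI)
      fix i :: nat assume i: "i \<le> 6"
      show "linear (R i)" using i Ai
        by (intro linearI) (simp_all add: R_def Q.P_simps linear_add linear_scale)
      show "R i x \<bullet> y = x \<bullet> R i y" for x y
        using Rdot[of i x y] Rdot[of i y x] Q.sym[OF i] by (simp add: inner_commute)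
      fix j :: nat and x assume j: "j \<le> 6"
      have "R i (R j x) + R j (R i x) = inv A (Q i (Q j (A x)) + Q j (Q i (A x)))"
        using Ai by (simp add: R_def Ainv linear_add)
      also have "\<dots> = inv A ((if i = j then 2 else 0) *\<^sub>R A x)"
        using i j Q.clifford by (simp add: clifford_system_def)
      finally show "R i (R j x) + R j (R i x) = (if i = j then 2 else 0) *\<^sub>R x"
        using Ai by (simp add: linear_scale Ainv linear_0)
    qed
    then interpret R: clifford 6 R by unfold_locales
    have Rq: "R.q x = Q.q (A x)" for x by (simp add: R.q_def Q.q_def Rdot)
    interpret clifford_pair P R
    proof
      fix x :: "real ^ 32" assume x: "norm x = 1" "P.q x = 1"
      \<comment> \<open>Focal points are recognized by lying on no member of the family. A value
        strictly between 0 and 1 would put \<open>A x\<close> on a member of \<open>G\<close>, hence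
        \<open>x\<close> on a member of \<open>F\<close>, contrary to
        \<open>P.q x = 1\<close>.\<close>
      show "R.q x = 0 \<or> R.q x = 1"
      proof (rule ccontr)
        assume "\<not> (R.q x = 0 \<or> R.q x = 1)"
        hence "1 - 2 * R.q x \<in> {-1<..<1}" using R.q_nonneg[of x] R.q_le[OF x(1)] by auto
        hence "clifford_hypersurface 6 Q (1 - 2 * R.q x) \<in> G" unfolding G by blast
        then obtain c where c: "c \<in> {-1<..<1}"
          and eq: "clifford_hypersurface 6 Q (1 - 2 * R.q x) = A ` clifford_hypersurface 9 P c"
          unfolding AG[symmetric] F by blast
        have "A x \<in> clifford_hypersurface 6 Q (1 - 2 * R.q x)"
          using A x by (simp add: clifford_hypersurface_def Q.clifford_function_eq Rq orthogonal_transformation_norm)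
        then obtain y where "A x = A y" "y \<in> clifford_hypersurface 9 P c" unfolding eq by blast
        hence "x \<in> clifford_hypersurface 9 P c" by (metis Ainv(2))
        thus False using x c by (simp add: clifford_hypersurface_def P.clifford_function_eq)
      qed
    qed
    show False by (rule no_clifford_pair)
  qed
  ultimately show ?thesis by blast
qed

end
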